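(* The strict inequality $\mathcal S^{\rm Sr}_s(\mathbb{R}^n_+)<\mathcal S_s$ holds provided that one of the following conditions is satisfied: (i) $n\ge2$ and $s<1$ is close enough to $1$ (that is, for every integer $n\ge 2$ there is $s_0=s_0(n)\in(0,1)$ such that the inequality holds for all $s\in(s_0,1)$); (ii) $n=1$ and $s<\frac12$ is close enough to $\frac12$ (that is, for $n=1$ there is $s_0\in(0,\frac12)$ such that the inequality holds for all $s\in(s_0,\frac12)$).
   Context: Here $s\in(0,1)$ and $n>2s$. Notation: $\mathbb{R}^n_\pm=\{x\in\mathbb{R}^n: x_1\gtrless0\}$, $2^*_s=\frac{2n}{n-2s}$, $C_{n,s}=\frac{s2^{2s}\Gamma(\frac n2+s)}{\pi^{n/2}\Gamma(1-s)}$, and for measurable $Z\subseteq\mathbb{R}^n\times\mathbb{R}^n$ $$\mathcal E_s(u;Z)=\frac{C_{n,s}}{2}\iint_Z\frac{(u(x)-u(y))^2}{|x-y|^{n+2s}}\,dx\,dy .$$ $\mathcal D^s(\mathbb{R}^n)=\{u\in L^{2^*_s}(\mathbb{R}^n): \mathcal E_s(u;\mathbb{R}^n\times\mathbb{R}^n)<\infty\}$ and $$\mathcal S_s=\inf_{u\in\mathcal D^s(\mathbb{R}^n),\,u\neq0}\frac{\mathcal E_s(u;\mathbb{R}^n\times\mathbb{R}^n)}{\|u\|^2_{L^{2^*_s}(\mathbb{R}^n)}}.$$ $\mathcal D^s_{\rm Sr}(\mathbb{R}^n_+)=\{u:\mathbb{R}^n\to\mathbb{R}\text{ measurable}: u|_{\mathbb{R}^n_+}\in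 L^{2^*_s}(\mathbb{R}^n_+),\ \mathcal E_s(u;\mathbb{R}^{2n}\setminus(\mathbb{R}^n_-)^2)<\infty\}$ and $$\mathcal S^{\rm Sr}_s(\mathbb{R}^n_+)=\inf_{u\in\mathcal D^s_{\rm Sr}(\mathbb{R}^n_+),\,u|_{\mathbb{R}^n_+}\neq0}\frac{\mathcal E_s(u;\mathbb{R}^{2n}\setminus(\mathbb{R}^n_-)^2)}{\|u\|^2_{L^{2^*_s}(\mathbb{R}^n_+)}}.$$ *)

theory Defs
  imports "HOL-Analysis.Analysis"
begin

text \<open>
  Euclidean space is \<open>real ^ 'n\<close>, of dimension \<open>CARD('n)\<close>. The index type \<open>'n\<close> has no
  distinguished element, so the coordinate \<open>k\<close> playing the role of the first one is a parameter.
\<close>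

definition halfspace_pos :: "'n::finite \<Rightarrow> (real ^ 'n) set" where
  "halfspace_pos k = {x. x $ k > 0}"

definition halfspace_neg :: "'n::finite \<Rightarrow> (real ^ 'n) set" where
  "halfspace_neg k = {x. x $ k < 0}"

definition crit_exp :: "nat \<Rightarrow> real \<Rightarrow> real" where
  "crit_exp n s = 2 * real n / (real n - 2 * s)"

definition frac_const :: "nat \<Rightarrow> real \<Rightarrow> real" where
  "frac_const n s =
     s * 2 powr (2 * s) * Gamma (real n / 2 + s) / (pi powr (real n / 2) * Gamma (1 - s))"

text \<open>
  The energy is an extended nonnegative number. On the diagonal the integrand is \<open>0 / 0 = 0\<close>;
  the diagonal is a null set.
\<close>

definition energy ::
    "real \<Rightarrow> ((real ^ 'n::finite) \<times> (real ^ 'n)) set \<Rightarrow> (real ^ 'n \<Rightarrow> real) \<Rightarrow> ennreal" where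
  "energy s Z u =
     ennreal (frac_const CARD('n) s / 2) *
     (\<integral>\<^sup>+ (x, y) \<in> Z.
        ennreal ((u x - u y)\<^sup>2 / norm (x - y) powr (real CARD('n) + 2 * s)) \<partial>lebesgue)"

definition in_Lp :: "real \<Rightarrow> 'a::euclidean_space set \<Rightarrow> ('a \<Rightarrow> real) \<Rightarrow> bool" where
  "in_Lp p S u \<longleftrightarrow>
     u \<in> borel_measurable (lebesgue_on S) \<and>
     (\<integral>\<^sup>+ x. ennreal (\<bar>u x\<bar> powr p) \<partial>lebesgue_on S) < \<infinity>"

text \<open>Only meaningful for functions satisfying \<open>in_Lp p S\<close>.\<close>

definition Lp_norm :: "real \<Rightarrow> 'a::euclidean_space set \<Rightarrow> ('a \<Rightarrow> real) \<Rightarrow> real" where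
  "Lp_norm p S u =
     enn2real (\<integral>\<^sup>+ x. ennreal (\<bar>u x\<bar> powr p) \<partial>lebesgue_on S) powr (1 / p)"

definition space_D :: "real \<Rightarrow> (real ^ 'n::finite \<Rightarrow> real) set" where
  "space_D s = {u. in_Lp (crit_exp CARD('n) s) UNIV u \<and> energy s (UNIV \<times> UNIV) u < \<infinity>}"

text \<open>
  The best constants are infima in \<^typ>\<open>ennreal\<close>. The condition that \<open>u\<close> is nonzero is read
  in the Lebesgue space, that is, up to null sets.
\<close>

definition sobolev_const :: "'n::finite itself \<Rightarrow> real \<Rightarrow> ennreal" where
  "sobolev_const _ s =
     (INF u \<in> {u \<in> space_D s. \<not> (AE x in lebesgue. u x = 0)}.
        energy s (UNIV \<times> UNIV) (u :: real ^ 'n \<Rightarrow> real) /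
        ennreal ((Lp_norm (crit_exp CARD('n) s) UNIV u)\<^sup>2))"

definition Sr_domain :: "'n::finite \<Rightarrow> ((real ^ 'n) \<times> (real ^ 'n)) set" where
  "Sr_domain k = UNIV - halfspace_neg k \<times> halfspace_neg k"

definition space_D_Sr :: "'n::finite \<Rightarrow> real \<Rightarrow> (real ^ 'n \<Rightarrow> real) set" where
  "space_D_Sr k s =
     {u \<in> borel_measurable lebesgue.
        in_Lp (crit_exp CARD('n) s) (halfspace_pos k) u \<and> energy s (Sr_domain k) u < \<infinity>}"

definition sobolev_const_Sr :: "'n::finite \<Rightarrow> real \<Rightarrow> ennreal" where
  "sobolev_const_Sr k s =
     (INF u \<in> {u \<in> space_D_Sr k s. \<not> (AE x in lebesgue_on (halfspace_pos k). u x = 0)}.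
        energy s (Sr_domain k) u /
        ennreal ((Lp_norm (crit_exp CARD('n) s) (halfspace_pos k) u)\<^sup>2))"

end

theory Submission
  imports Defs "HOL-Probability.Distribution_Functions"
begin

text \<open>
Write \<open>a\<close>, \<open>b\<close> for the energies of \<open>u\<close> inside \<open>{x\<^sub>k > 0}\<close> and inside \<open>{x\<^sub>k < 0}\<close>, and \<open>c\<close> for
the energy between the two, so that the full energy is \<open>a + b + 2c\<close>. After a translation the
hyperplane \<open>{x\<^sub>k = 0}\<close> halves \<open>M = \<integral>\<bar>u\<bar>\<^sup>p\<close>, where \<open>p\<close> is the critical exponent. Each half of \<open>u\<close> then
competes in the semirestricted problem, with a free choice of values on the other side. Adding the
two competitors and using \<open>1 - 2/p = 2s/n\<close> shows the following: if the two semirestricted energies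
sum to at most \<open>\<beta> (a + b + 2c)\<close>, then the semirestricted constant is at most
\<open>\<beta> 2 powr (-2s/n)\<close> times the full one. So it is enough to find extensions with
\<open>\<beta> < 2 powr (2s/n)\<close> (\<open>sobolev_const_Sr_less\<close>). As this comparison applies to every \<open>u\<close>, the strict
inequality follows once the full constant is known to be finite (a bump function) and positive.

Two extensions are used. Keeping \<open>u\<close> itself costs \<open>a + b + 4c\<close>. Reflecting each half evenly costs at
most \<open>3(a + b)\<close>, because replacing one of two points on the same side by its mirror image increases their distance.
A convex combination of the two bounds gives \<open>\<beta> = 3/2\<close> for all \<open>n\<close> and \<open>s\<close>, and this is below \<open>2 powr (2s/n)\<close>
when \<open>n = 1\<close> and \<open>s\<close> is close to \<open>1/2\<close>.

For \<open>n \<ge> 2\<close> and \<open>s\<close> close to 1 the point is that the energy between a half and its even reflection is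
at most \<open>\<eta> a\<close>, with \<open>\<eta>\<close> as small as desired (\<open>reflected_gagliardo_small\<close>), so \<open>\<beta> = 1 + 2\<eta>\<close> is close to 1.
This is a telescoping argument. The kernel now involves the distance \<open>r\<close> from \<open>x\<close> to the mirror image
of \<open>y\<close>, which exceeds the heights of both points. Comparing \<open>x\<close> and \<open>y\<close> with a third point lifted above
them by a multiple of \<open>r\<close> reduces to increments \<open>u (x + g) - u x\<close> where \<open>g\<close> points upwards and \<open>x\<close> is
at height at most \<open>\<bar>g\<bar>\<close> (\<open>reflected_gagliardo_le_cone_energy\<close>). Bisecting \<open>g\<close> and absorbing the lower half
reduces further to heights comparable to \<open>\<bar>g\<bar>\<close> (\<open>cone_energy_midpoint\<close>). Finally, \<open>g\<close> can be cut into \<open>N\<close> equal pieces at the price of a factor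
\<open>N powr (2 - 2s)\<close>, which is almost 1, while the resulting contributions for \<open>N = 1, 12, 12\<^sup>2, \<dots>\<close> occupy
disjoint ranges of the ratio height to length (\<open>cone_energy_le_bands\<close>). Each of \<open>J\<close> such ranges
would carry nearly the same energy, and together they carry at most \<open>a\<close>.

Positivity of the full constant is the fractional Sobolev inequality without a sharp constant,
proved by a pointwise estimate (\<open>gagliardo_lower_bound\<close>).
\<close>

section \<open>Change of variables and Tonelli for Lebesgue measure\<close>

lemma nn_integral_lborel_affine:
  fixes f :: "'a::euclidean_space \<Rightarrow> ennreal"
  assumes [measurable]: "f \<in> borel_measurable borel" and "c \<noteq> 0"
  shows "(\<integral>\<^sup>+x. f x \<partial>lborel) = ennreal (\<bar>c\<bar> ^ DIM('a)) * (\<integral>\<^sup>+x. f (t + c *\<^sub>R x) \<partial>lborel)"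
  by (subst lborel_affine[OF \<open>c \<noteq> 0\<close>, of t])
     (simp add: nn_integral_density nn_integral_distr nn_integral_cmult)

lemma nn_integral_lborel_translate:
  fixes f :: "'a::euclidean_space \<Rightarrow> ennreal"
  assumes "f \<in> borel_measurable borel"
  shows "(\<integral>\<^sup>+x. f (x + t) \<partial>lborel) = (\<integral>\<^sup>+x. f x \<partial>lborel)"
  using nn_integral_lborel_affine[OF assms, of 1 t] by (simp add: add.commute)

definition reflect :: "'n::finite \<Rightarrow> real ^ 'n \<Rightarrow> real ^ 'n" where
  "reflect k x = x - (2 * x $ k) *\<^sub>R axis k 1"

lemma reflect_nth: "reflect k x $ i = (if i = k then - x $ k else x $ i)"
  by (simp add: reflect_def axis_def)

lemma reflect_reflect [simp]: "reflect k (reflect k x) = x"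
  by (simp add: vec_eq_iff reflect_nth)

lemma reflect_diff: "reflect k x - reflect k y = reflect k (x - y)"
  by (simp add: vec_eq_iff reflect_nth)

lemma norm_reflect [simp]: "norm (reflect k x) = norm x"
  unfolding norm_vec_def L2_set_def by (intro arg_cong[where f=sqrt] sum.cong) (auto simp: reflect_nth)

lemma borel_measurable_reflect [measurable]: "reflect k \<in> borel_measurable borel"
  unfolding reflect_def by (intro borel_measurable_continuous_onI continuous_intros)

lemma nn_integral_lborel_reflect:
  fixes f :: "real ^ 'n::finite \<Rightarrow> ennreal"
  assumes [measurable]: "f \<in> borel_measurable borel"
  shows "(\<integral>\<^sup>+x. f (reflect k x) \<partial>lborel) = (\<integral>\<^sup>+x. f x \<partial>lborel)"
proof -
  let ?c = "\<lambda>j::real^'n. if j = axis k 1 then -1 else (1::real)"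
  let ?T = "\<lambda>x::real^'n. 0 + (\<Sum>j\<in>Basis. (?c j * (x \<bullet> j)) *\<^sub>R j)"
  have T: "?T x = reflect k x" for x
  proof (rule euclidean_eqI)
    fix b :: "real ^ 'n" assume b: "b \<in> Basis"
    then obtain i where i: "b = axis i 1" by (auto simp: Basis_vec_def)
    have "?T x \<bullet> b = ?c b * (x \<bullet> b)"
      using b by (simp add: inner_sum_left inner_Basis if_distrib sum.delta cong: if_cong)
    also have "\<dots> = reflect k x \<bullet> b"
      by (auto simp: i inner_axis reflect_nth axis_eq_axis)
    finally show "?T x \<bullet> b = reflect k x \<bullet> b" .
  qed
  have "lborel = density (distr lborel borel ?T) (\<lambda>_. ennreal (\<Prod>j\<in>Basis. \<bar>?c j\<bar>))"
    using lborel_affine_euclidean[where c="?c" and t=0] by simp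
  also have "(\<Prod>j\<in>(Basis::(real^'n) set). \<bar>?c j\<bar>) = 1" by (intro prod.neutral) auto
  finally have "lborel = density (distr lborel borel (reflect k)) (\<lambda>_. 1)"
    unfolding T by simp
  then have "lborel = distr lborel borel (reflect k)" by (simp add: density_1)
  then have "(\<integral>\<^sup>+x. f x \<partial>lborel) = (\<integral>\<^sup>+x. f x \<partial>distr lborel borel (reflect k))" by simp
  then show ?thesis by (simp add: nn_integral_distr)
qed

lemma halfspace_measurable [measurable]:
  "halfspace_pos k \<in> sets borel" "halfspace_neg k \<in> sets borel"
  by (simp_all add: halfspace_pos_def halfspace_neg_def)

lemma nth_measurable [measurable]: "(\<lambda>x::real^'n::finite. x $ k) \<in> borel_measurable borel"
  by simp

lemma AE_off_hyperplane: "AE x in lborel. x $ k \<noteq> (t::real)" for k :: "'n::finite"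
proof -
  have "negligible {x. (axis k 1 :: real^'n) \<bullet> x = t}"
    by (intro negligible_hyperplane) auto
  then have "{x. x $ k = t} \<in> null_sets (completion lborel)"
    by (simp add: negligible_iff_null_sets inner_axis')
  then have "{x. x $ k = t} \<in> null_sets lborel"
    by (subst (asm) null_sets_completion_iff) auto
  then show ?thesis by (auto dest: AE_not_in)
qed

lemma nn_integral_lborel_swap:
  fixes f :: "'a::euclidean_space \<Rightarrow> 'b::euclidean_space \<Rightarrow> ennreal"
  assumes "case_prod f \<in> borel_measurable (lborel \<Otimes>\<^sub>M lborel)"
  shows "(\<integral>\<^sup>+x. \<integral>\<^sup>+y. f x y \<partial>lborel \<partial>lborel) = (\<integral>\<^sup>+y. \<integral>\<^sup>+x. f x y \<partial>lborel \<partial>lborel)"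
  using assms by (rule lborel_pair.Fubini'[symmetric])

section \<open>Gagliardo double integrals\<close>

definition gagliardo :: "real \<Rightarrow> (real ^ 'n::finite \<Rightarrow> real) \<Rightarrow> (real ^ 'n) set \<Rightarrow> (real ^ 'n) set \<Rightarrow> ennreal" where
  "gagliardo q v A B =
     (\<integral>\<^sup>+x. \<integral>\<^sup>+y. ennreal ((v x - v y)\<^sup>2 / norm (x - y) powr q) * indicator A x * indicator B y
       \<partial>lborel \<partial>lborel)"

text \<open>
The energy between the two halfspaces of the function that agrees with \<open>v\<close> above the hyperplane and
is even in \<open>x\<^sub>k\<close>; the lower point has been reflected back to the upper halfspace.
\<close>

definition reflected_gagliardo :: "'n::finite \<Rightarrow> real \<Rightarrow> (real ^ 'n \<Rightarrow> real) \<Rightarrow> ennreal" where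
  "reflected_gagliardo k q v =
     (\<integral>\<^sup>+x. \<integral>\<^sup>+y. ennreal ((v x - v y)\<^sup>2 / norm (x - reflect k y) powr q) *
         indicator (halfspace_pos k) x * indicator (halfspace_pos k) y \<partial>lborel \<partial>lborel)"

section \<open>Energy of increments in an upward cone\<close>

text \<open>
The layer is given by absolute heights and not by multiples of the length of \<open>g\<close>, so that translating
the integration variable only shifts its two bounds.
\<close>

definition slab_diff :: "'n::finite \<Rightarrow> (real ^ 'n \<Rightarrow> real) \<Rightarrow> real ^ 'n \<Rightarrow> real \<Rightarrow> real \<Rightarrow> ennreal" where
  "slab_diff k v g \<alpha> \<beta> =
     (\<integral>\<^sup>+x. (if \<alpha> < x $ k \<and> x $ k \<le> \<beta> then ennreal ((v (x + g) - v x)\<^sup>2) else 0) \<partial>lborel)"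

text \<open>
The slope of the cone is the one that the lifted points in \<open>lifted_ball_geometry\<close> provide.
\<close>

definition up_cone :: "'n::finite \<Rightarrow> (real ^ 'n) set" where
  "up_cone k = {g. norm g \<le> 3 * g $ k}"

text \<open>
The part of the Gagliardo energy carried by pairs \<open>(x, x + g)\<close> for which the ratio of the height of \<open>x\<close>
to the length of \<open>g\<close> lies in a given range. The condition is invariant under dilations.
\<close>

definition cone_energy :: "'n::finite \<Rightarrow> real \<Rightarrow> (real ^ 'n \<Rightarrow> real) \<Rightarrow> real \<Rightarrow> real \<Rightarrow> ennreal" where
  "cone_energy k q v a b =
     (\<integral>\<^sup>+g. (if g \<in> up_cone k
             then ennreal (norm g powr (- q)) * slab_diff k v g (a * norm g) (b * norm g) else 0) \<partial>lborel)"

lemma up_cone_measurable [measurable]: "up_cone k \<in> sets borel"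
  unfolding up_cone_def by measurable

lemma slab_diff_measurable [measurable]:
  fixes v :: "real ^ 'n::finite \<Rightarrow> real"
  assumes [measurable]: "v \<in> borel_measurable borel"
    "f \<in> borel_measurable borel" "a \<in> borel_measurable borel" "b \<in> borel_measurable borel"
  shows "(\<lambda>g::real^'n. slab_diff k v (f g) (a g) (b g)) \<in> borel_measurable borel"
  unfolding slab_diff_def by measurable

lemma slab_diff_mono:
  assumes "\<alpha>' \<le> \<alpha>" "\<beta> \<le> \<beta>'"
  shows "slab_diff k v g \<alpha> \<beta> \<le> slab_diff k v g \<alpha>' \<beta>'"
  unfolding slab_diff_def using assms by (intro nn_integral_mono) auto

lemma slab_diff_split:
  fixes v :: "real ^ 'n::finite \<Rightarrow> real"
  assumes [measurable]: "v \<in> borel_measurable borel" and "\<alpha> \<le> \<gamma>" "\<gamma> \<le> \<beta>"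
  shows "slab_diff k v g \<alpha> \<beta> = slab_diff k v g \<alpha> \<gamma> + slab_diff k v g \<gamma> \<beta>"
  unfolding slab_diff_def using assms(2,3)
  by (subst nn_integral_add[symmetric]) (auto intro!: nn_integral_cong)

lemma slab_diff_shift:
  fixes v :: "real ^ 'n::finite \<Rightarrow> real"
  assumes [measurable]: "v \<in> borel_measurable borel"
  shows "(\<integral>\<^sup>+x. (if \<alpha> < x $ k \<and> x $ k \<le> \<beta> then ennreal ((v (x + t + g) - v (x + t))\<^sup>2) else 0) \<partial>lborel)
       = slab_diff k v g (\<alpha> + t $ k) (\<beta> + t $ k)"
  unfolding slab_diff_def
  by (subst nn_integral_lborel_translate[of _ t, symmetric])
     (auto intro!: nn_integral_cong)

text \<open>
Along \<open>x, x + h, \<dots>, x + N h\<close> the increment telescopes, and Cauchy-Schwarz costs a factor \<open>N\<close>. The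
i-th step starts \<open>i h\<^sub>k\<close> higher, which moves the layer by that amount.
\<close>

lemma slab_diff_telescope:
  fixes v :: "real ^ 'n::finite \<Rightarrow> real"
  assumes [measurable]: "v \<in> borel_measurable borel"
  shows "slab_diff k v (real N *\<^sub>R h) \<alpha> \<beta>
           \<le> of_nat N * (\<Sum>i<N. slab_diff k v h (\<alpha> + real i * h $ k) (\<beta> + real i * h $ k))"
proof -
  let ?D = "\<lambda>i x. (v (x + real i *\<^sub>R h + h) - v (x + real i *\<^sub>R h))\<^sup>2"
  have pt: "(v (x + real N *\<^sub>R h) - v x)\<^sup>2 \<le> real N * (\<Sum>i<N. ?D i x)" for x
  proof -
    let ?a = "\<lambda>i. v (x + real (Suc i) *\<^sub>R h) - v (x + real i *\<^sub>R h)"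
    have "v (x + real N *\<^sub>R h) - v x = (\<Sum>i<N. ?a i)"
      by (subst sum_lessThan_telescope) simp
    then have "(v (x + real N *\<^sub>R h) - v x)\<^sup>2 \<le> (\<Sum>i<N. (?a i)\<^sup>2) * real N"
      using sum_squared_le_sum_of_squares[of ?a "{..<N}"] by simp
    also have "(\<Sum>i<N. (?a i)\<^sup>2) = (\<Sum>i<N. ?D i x)"
      by (intro sum.cong) (simp_all add: algebra_simps)
    finally show ?thesis by (simp add: mult.commute)
  qed
  have "slab_diff k v (real N *\<^sub>R h) \<alpha> \<beta>
      \<le> (\<integral>\<^sup>+x. of_nat N * (\<Sum>i<N. if \<alpha> < x $ k \<and> x $ k \<le> \<beta> then ennreal (?D i x) else 0) \<partial>lborel)"
    unfolding slab_diff_def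
  proof (intro nn_integral_mono, goal_cases)
    case (1 x)
    have "ennreal ((v (x + real N *\<^sub>R h) - v x)\<^sup>2) \<le> ennreal (real N * (\<Sum>i<N. ?D i x))"
      by (rule ennreal_leI[OF pt])
    also have "\<dots> = of_nat N * (\<Sum>i<N. ennreal (?D i x))"
      by (simp add: ennreal_mult sum_nonneg ennreal_of_nat_eq_real_of_nat flip: sum_ennreal)
    finally show ?case by auto
  qed
  also have "\<dots> = of_nat N * (\<Sum>i<N. \<integral>\<^sup>+x. (if \<alpha> < x $ k \<and> x $ k \<le> \<beta> then ennreal (?D i x) else 0) \<partial>lborel)"
    by (subst nn_integral_cmult, measurable) (subst nn_integral_sum, auto)
  also have "\<dots> = of_nat N * (\<Sum>i<N. slab_diff k v h (\<alpha> + real i * h $ k) (\<beta> + real i * h $ k))"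
    by (subst slab_diff_shift) auto
  finally show ?thesis .
qed

lemma up_cone_scale: "c > 0 \<Longrightarrow> c *\<^sub>R g \<in> up_cone k \<longleftrightarrow> g \<in> up_cone k"
  by (auto simp: up_cone_def)

lemma cone_energy_scale:
  fixes v :: "real ^ 'n::finite \<Rightarrow> real"
  assumes [measurable]: "v \<in> borel_measurable borel" and "N > 0"
  shows "cone_energy k q v a b = ennreal (real N powr (real CARD('n) - q)) *
    (\<integral>\<^sup>+h. (if h \<in> up_cone k then ennreal (norm h powr (- q)) *
         slab_diff k v (real N *\<^sub>R h) (a * (real N * norm h)) (b * (real N * norm h)) else 0) \<partial>lborel)"
proof -
  have "cone_energy k q v a b = ennreal (real N ^ CARD('n)) *
    (\<integral>\<^sup>+h. (if h \<in> up_cone k then ennreal (norm (real N *\<^sub>R h) powr (- q)) *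
         slab_diff k v (real N *\<^sub>R h) (a * norm (real N *\<^sub>R h)) (b * norm (real N *\<^sub>R h)) else 0) \<partial>lborel)"
    unfolding cone_energy_def using \<open>N > 0\<close>
    by (subst nn_integral_lborel_affine[of _ "real N" 0]) (auto simp: up_cone_scale cong: if_cong)
  also have "(\<integral>\<^sup>+h. (if h \<in> up_cone k then ennreal (norm (real N *\<^sub>R h) powr (- q)) *
         slab_diff k v (real N *\<^sub>R h) (a * norm (real N *\<^sub>R h)) (b * norm (real N *\<^sub>R h)) else 0) \<partial>lborel)
    = (\<integral>\<^sup>+h. ennreal (real N powr (- q)) * (if h \<in> up_cone k then ennreal (norm h powr (- q)) *
         slab_diff k v (real N *\<^sub>R h) (a * (real N * norm h)) (b * (real N * norm h)) else 0) \<partial>lborel)"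
    by (intro nn_integral_cong) (auto simp: powr_mult ennreal_mult mult.assoc)
  also have "\<dots> = ennreal (real N powr (- q)) * (\<integral>\<^sup>+h. (if h \<in> up_cone k then ennreal (norm h powr (- q)) *
         slab_diff k v (real N *\<^sub>R h) (a * (real N * norm h)) (b * (real N * norm h)) else 0) \<partial>lborel)"
    by (rule nn_integral_cmult) measurable
  also have "ennreal (real N ^ CARD('n)) * \<dots> = ennreal (real N powr (real CARD('n) - q)) *
    (\<integral>\<^sup>+h. (if h \<in> up_cone k then ennreal (norm h powr (- q)) *
         slab_diff k v (real N *\<^sub>R h) (a * (real N * norm h)) (b * (real N * norm h)) else 0) \<partial>lborel)"
    using \<open>N > 0\<close> by (simp add: mult.assoc[symmetric] ennreal_mult[symmetric] powr_diff powr_minus powr_realpow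
       divide_inverse)
  finally show ?thesis .
qed

lemma ennreal_double: "a \<ge> 0 \<Longrightarrow> ennreal (2 * a) * X = ennreal a * (2 * X)"
  by (simp add: ennreal_mult mult_ac)

text \<open>
Halving \<open>g\<close> produces a lower and an upper half-increment. The upper one starts at a height comparable
to its length, since \<open>g\<close> points upwards; the lower one does so as well or is again of the original kind.
When \<open>2 * 2 powr (n - q) < 1\<close> the energy on the right that is of the original kind can be absorbed.
\<close>

lemma cone_energy_midpoint:
  fixes v :: "real ^ 'n::finite \<Rightarrow> real"
  assumes [measurable]: "v \<in> borel_measurable borel"
  shows "cone_energy k q v 0 1 \<le> ennreal (2 * 2 powr (real CARD('n) - q)) *
           (cone_energy k q v 0 1 + 2 * cone_energy k q v (1/3) 3)"
proof -
  have st: "slab_diff k v (2 *\<^sub>R h) 0 (2 * norm h)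
      \<le> 2 * (slab_diff k v h 0 (norm h) + 2 * slab_diff k v h (norm h / 3) (3 * norm h))"
    if h: "h \<in> up_cone k" for h
  proof -
    have hk: "norm h / 3 \<le> h $ k" "h $ k \<le> norm h"
      using h component_le_norm_cart[of h k] by (auto simp: up_cone_def)
    have 1: "slab_diff k v (2 *\<^sub>R h) 0 (2 * norm h)
        \<le> 2 * (slab_diff k v h 0 (2 * norm h) + slab_diff k v h (h $ k) (2 * norm h + h $ k))"
      using slab_diff_telescope[OF assms, of k 2 h 0 "2 * norm h"]
      by (simp add: numeral_2_eq_2 lessThan_Suc add.commute)
    have 2: "slab_diff k v h 0 (2 * norm h) = slab_diff k v h 0 (norm h) + slab_diff k v h (norm h) (2 * norm h)"
      by (rule slab_diff_split) auto
    have 3: "slab_diff k v h (norm h) (2 * norm h) \<le> slab_diff k v h (norm h / 3) (3 * norm h)"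
      by (rule slab_diff_mono) auto
    have 4: "slab_diff k v h (h $ k) (2 * norm h + h $ k) \<le> slab_diff k v h (norm h / 3) (3 * norm h)"
      using hk by (intro slab_diff_mono) auto
    have "slab_diff k v h 0 (2 * norm h) + slab_diff k v h (h $ k) (2 * norm h + h $ k)
        \<le> slab_diff k v h 0 (norm h) + 2 * slab_diff k v h (norm h / 3) (3 * norm h)"
      using add_left_mono[OF add_mono[OF 3 4], of "slab_diff k v h 0 (norm h)"]
      by (simp only: 2 mult_2[of "slab_diff k v h (norm h / 3) (3 * norm h)"] add.assoc)
    from order_trans[OF 1 mult_left_mono[OF this]] show ?thesis by simp
  qed
  have "cone_energy k q v 0 1 \<le> ennreal (2 powr (real CARD('n) - q)) *
    (\<integral>\<^sup>+h. (if h \<in> up_cone k then ennreal (norm h powr (- q)) *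
         (2 * (slab_diff k v h 0 (norm h) + 2 * slab_diff k v h (norm h / 3) (3 * norm h))) else 0) \<partial>lborel)"
    using st
    by (subst cone_energy_scale[of v 2]) (auto intro!: mult_left_mono nn_integral_mono)
  also have "(\<integral>\<^sup>+h. (if h \<in> up_cone k then ennreal (norm h powr (- q)) *
         (2 * (slab_diff k v h 0 (norm h) + 2 * slab_diff k v h (norm h / 3) (3 * norm h))) else 0) \<partial>lborel)
     = 2 * (cone_energy k q v 0 1 + 2 * cone_energy k q v (1/3) 3)"
  proof -
    have "(\<integral>\<^sup>+h. (if h \<in> up_cone k then ennreal (norm h powr (- q)) *
         (2 * (slab_diff k v h 0 (norm h) + 2 * slab_diff k v h (norm h / 3) (3 * norm h))) else 0) \<partial>lborel)
      = (\<integral>\<^sup>+h. 2 * ((if h \<in> up_cone k then ennreal (norm h powr (- q)) * slab_diff k v h 0 (norm h) else 0)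
         + 2 * (if h \<in> up_cone k then ennreal (norm h powr (- q)) * slab_diff k v h (norm h / 3) (3 * norm h) else 0)) \<partial>lborel)"
      by (intro nn_integral_cong) (auto simp: algebra_simps)
    then show ?thesis
      by (simp add: nn_integral_cmult nn_integral_add cone_energy_def cong: if_cong)
  qed
  finally show ?thesis by (subst ennreal_double) auto
qed

text \<open>
Here \<open>g\<close> is cut into \<open>N\<close> pieces. They start at heights between that of \<open>x\<close> and that of \<open>x + g\<close>, hence about
\<open>N\<close> times higher relative to their length. For \<open>q = n + 2s\<close> the factor is \<open>N powr (2 - 2s)\<close>, which tends
to 1 as \<open>s\<close> does.
\<close>

lemma cone_energy_descend:
  fixes v :: "real ^ 'n::finite \<Rightarrow> real"
  assumes [measurable]: "v \<in> borel_measurable borel" and "N > 0"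
  shows "cone_energy k q v (1/3) 3 \<le> ennreal (real N powr (2 + real CARD('n) - q)) *
           cone_energy k q v (real N / 3) (4 * real N)"
proof -
  have st: "slab_diff k v (real N *\<^sub>R h) (1/3 * (real N * norm h)) (3 * (real N * norm h))
      \<le> ennreal ((real N)\<^sup>2) * slab_diff k v h (real N / 3 * norm h) (4 * real N * norm h)"
    if h: "h \<in> up_cone k" for h
  proof -
    have hk: "0 \<le> h $ k" "h $ k \<le> norm h"
      using h component_le_norm_cart[of h k] norm_ge_zero[of h] by (auto simp: up_cone_def simp del: norm_ge_zero)
    have "slab_diff k v (real N *\<^sub>R h) (1/3 * (real N * norm h)) (3 * (real N * norm h))
        \<le> of_nat N * (\<Sum>i<N. slab_diff k v h (1/3 * (real N * norm h) + real i * h $ k) (3 * (real N * norm h) + real i * h $ k))"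
      by (rule slab_diff_telescope) fact
    also have "\<dots> \<le> of_nat N * (\<Sum>i<N. slab_diff k v h (real N / 3 * norm h) (4 * real N * norm h))"
    proof (intro mult_left_mono sum_mono slab_diff_mono)
      fix i assume "i \<in> {..<N}"
      then have "real i * h $ k \<le> real N * norm h" using hk by (intro mult_mono) auto
      then show "3 * (real N * norm h) + real i * h $ k \<le> 4 * real N * norm h" by simp
      show "real N / 3 * norm h \<le> 1/3 * (real N * norm h) + real i * h $ k" using hk by simp
    qed simp
    also have "\<dots> = ennreal ((real N)\<^sup>2) * slab_diff k v h (real N / 3 * norm h) (4 * real N * norm h)"
      by (simp add: ennreal_of_nat_eq_real_of_nat power2_eq_square ennreal_mult mult.assoc)
    finally show ?thesis .
  qed
  have "cone_energy k q v (1/3) 3 \<le> ennreal (real N powr (real CARD('n) - q)) *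
    (\<integral>\<^sup>+h. ennreal ((real N)\<^sup>2) * (if h \<in> up_cone k then ennreal (norm h powr (- q)) *
         slab_diff k v h (real N / 3 * norm h) (4 * real N * norm h) else 0) \<partial>lborel)"
    using st
    by (subst cone_energy_scale[OF assms])
       (auto intro!: mult_left_mono nn_integral_mono simp: mult.left_commute[of "ennreal ((real N)\<^sup>2)"])
  also have "\<dots> = ennreal (real N powr (real CARD('n) - q)) * (ennreal ((real N)\<^sup>2) *
      cone_energy k q v (real N / 3) (4 * real N))"
    by (subst nn_integral_cmult) (auto simp: cone_energy_def)
  also have "\<dots> = ennreal (real N powr (2 + real CARD('n) - q)) * cone_energy k q v (real N / 3) (4 * real N)"
  proof -
    have "2 + real CARD('n) - q = (real CARD('n) - q) + real 2" by simp
    then have "real N powr (2 + real CARD('n) - q) = real N powr (real CARD('n) - q) * (real N)\<^sup>2"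
      using \<open>N > 0\<close> by (simp only: powr_add) (simp add: powr_numeral)
    then show ?thesis by (simp add: ennreal_mult mult.assoc)
  qed
  finally show ?thesis .
qed

lemma sum_at_most_one_le:
  fixes c d :: ennreal
  assumes "finite I" "\<And>i j. i \<in> I \<Longrightarrow> j \<in> I \<Longrightarrow> P i \<Longrightarrow> P j \<Longrightarrow> i = j" "\<And>i. i \<in> I \<Longrightarrow> P i \<Longrightarrow> c \<le> d"
  shows "(\<Sum>i\<in>I. if P i then c else 0) \<le> d"
proof (cases "\<exists>i\<in>I. P i")
  case True
  then obtain i where i: "i \<in> I" "P i" by blast
  have "P j \<longleftrightarrow> j = i" if "j \<in> I" for j using assms(2)[OF that i(1)] i(2) by blast
  then have "(\<Sum>j\<in>I. if P j then c else 0) = (\<Sum>j\<in>I. if j = i then c else 0)"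
    by (intro sum.cong) simp_all
  then show ?thesis using assms(1,3) i by simp
next
  case False
  then have "(\<Sum>j\<in>I. if P j then c else 0) = 0" by (intro sum.neutral) auto
  then show ?thesis by simp
qed

lemma powr_minus_times: "norm (g::'a::real_normed_vector) powr (- q) * d = d / norm g powr q"
  by (simp add: powr_minus divide_inverse mult.commute)

text \<open>
Disjoint ranges of the ratio height to length select disjoint sets of pairs, and \<open>x + g\<close> stays in the
upper halfspace because \<open>g\<close> points upwards.
\<close>

lemma cone_energy_bands_le:
  fixes v :: "real ^ 'n::finite \<Rightarrow> real"
  assumes [measurable]: "v \<in> borel_measurable borel" and "finite J"
    and disj: "\<And>i j. i \<in> J \<Longrightarrow> j \<in> J \<Longrightarrow> i \<noteq> j \<Longrightarrow> b i \<le> a j \<or> b j \<le> a i"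
    and nonneg: "\<And>j. j \<in> J \<Longrightarrow> 0 \<le> a j"
  shows "(\<Sum>j\<in>J. cone_energy k q v (a j) (b j))
           \<le> gagliardo q v (halfspace_pos k) (halfspace_pos k)"
proof -
  have "(\<Sum>j\<in>J. cone_energy k q v (a j) (b j))
     = (\<integral>\<^sup>+g. \<integral>\<^sup>+x. (\<Sum>j\<in>J. if a j * norm g < x $ k \<and> x $ k \<le> b j * norm g then
          (if g \<in> up_cone k then ennreal (norm g powr (- q)) * ennreal ((v (x + g) - v x)\<^sup>2) else 0) else 0) \<partial>lborel \<partial>lborel)"
    unfolding cone_energy_def
  proof (subst nn_integral_sum[symmetric], measurable, intro nn_integral_cong)
    fix g :: "real ^ 'n"
    let ?D = "\<lambda>x. ennreal ((v (x + g) - v x)\<^sup>2)"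
    have "(if g \<in> up_cone k then ennreal (norm g powr (- q)) * slab_diff k v g \<alpha> \<beta> else 0)
      = (\<integral>\<^sup>+x. (if \<alpha> < x $ k \<and> x $ k \<le> \<beta> then
          (if g \<in> up_cone k then ennreal (norm g powr (- q)) * ?D x else 0) else 0) \<partial>lborel)" for \<alpha> \<beta>
    proof (cases "g \<in> up_cone k")
      case True
      have "ennreal (norm g powr (- q)) * slab_diff k v g \<alpha> \<beta> = (\<integral>\<^sup>+x. ennreal (norm g powr (- q)) *
          (if \<alpha> < x $ k \<and> x $ k \<le> \<beta> then ?D x else 0) \<partial>lborel)"
        unfolding slab_diff_def by (rule nn_integral_cmult[symmetric]) measurable
      also have "\<dots> = (\<integral>\<^sup>+x. (if \<alpha> < x $ k \<and> x $ k \<le> \<beta> then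
          (if g \<in> up_cone k then ennreal (norm g powr (- q)) * ?D x else 0) else 0) \<partial>lborel)"
        using True by (intro nn_integral_cong) simp
      finally show ?thesis using True by simp
    qed (simp cong: if_cong)
    then show "(\<Sum>j\<in>J. if g \<in> up_cone k then ennreal (norm g powr (- q)) *
          slab_diff k v g (a j * norm g) (b j * norm g) else 0)
      = (\<integral>\<^sup>+x. (\<Sum>j\<in>J. if a j * norm g < x $ k \<and> x $ k \<le> b j * norm g then
          (if g \<in> up_cone k then ennreal (norm g powr (- q)) * ?D x else 0) else 0) \<partial>lborel)"
      by (subst nn_integral_sum) auto
  qed
  also have "\<dots> \<le> (\<integral>\<^sup>+g. \<integral>\<^sup>+x. ennreal ((v x - v (x + g))\<^sup>2 / norm g powr q) *
      indicator (halfspace_pos k) x * indicator (halfspace_pos k) (x + g) \<partial>lborel \<partial>lborel)"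
  proof (intro nn_integral_mono)
    fix g x :: "real ^ 'n"
    show "(\<Sum>j\<in>J. if a j * norm g < x $ k \<and> x $ k \<le> b j * norm g then
          (if g \<in> up_cone k then ennreal (norm g powr (- q)) * ennreal ((v (x + g) - v x)\<^sup>2) else 0) else 0)
      \<le> ennreal ((v x - v (x + g))\<^sup>2 / norm g powr q) *
         indicator (halfspace_pos k) x * indicator (halfspace_pos k) (x + g)"
    proof (rule sum_at_most_one_le)
      fix i j
      assume ij: "i \<in> J" "j \<in> J"
        and h: "a i * norm g < x $ k \<and> x $ k \<le> b i * norm g" "a j * norm g < x $ k \<and> x $ k \<le> b j * norm g"
      have False if "b l \<le> a m" "a m * norm g < x $ k" "x $ k \<le> b l * norm g" for l m
        using mult_right_mono[OF that(1), of "norm g"] that by simp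
      then show "i = j" using disj[OF ij] h by blast
    next
      fix i assume "i \<in> J" and *: "a i * norm g < x $ k \<and> x $ k \<le> b i * norm g"
      then have x: "x $ k > 0" using mult_nonneg_nonneg[OF nonneg[of i] norm_ge_zero[of g]] by linarith
      show "(if g \<in> up_cone k then ennreal (norm g powr (- q)) * ennreal ((v (x + g) - v x)\<^sup>2) else 0)
        \<le> ennreal ((v x - v (x + g))\<^sup>2 / norm g powr q) *
           indicator (halfspace_pos k) x * indicator (halfspace_pos k) (x + g)"
      proof (cases "g \<in> up_cone k")
        case True
        then have "g $ k \<ge> 0" using norm_ge_zero[of g] unfolding up_cone_def by (simp del: norm_ge_zero)
        then show ?thesis using x True
          by (simp add: halfspace_pos_def ennreal_mult[symmetric] powr_minus_times power2_commute)
      qed simp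
    qed fact
  qed
  also have "\<dots> = (\<integral>\<^sup>+x. \<integral>\<^sup>+g. ennreal ((v x - v (x + g))\<^sup>2 / norm g powr q) *
      indicator (halfspace_pos k) x * indicator (halfspace_pos k) (x + g) \<partial>lborel \<partial>lborel)"
    by (rule nn_integral_lborel_swap) measurable
  also have "\<dots> = gagliardo q v (halfspace_pos k) (halfspace_pos k)"
    unfolding gagliardo_def
  proof (rule nn_integral_cong)
    fix x :: "real ^ 'n"
    show "(\<integral>\<^sup>+g. ennreal ((v x - v (x + g))\<^sup>2 / norm g powr q) *
        indicator (halfspace_pos k) x * indicator (halfspace_pos k) (x + g) \<partial>lborel)
      = (\<integral>\<^sup>+y. ennreal ((v x - v y)\<^sup>2 / norm (x - y) powr q) *
        indicator (halfspace_pos k) x * indicator (halfspace_pos k) y \<partial>lborel)"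
      using nn_integral_lborel_translate[of "\<lambda>y. ennreal ((v x - v y)\<^sup>2 / norm (x - y) powr q) *
        indicator (halfspace_pos k) x * indicator (halfspace_pos k) y" x]
      by (simp add: add.commute)
  qed
  finally show ?thesis .
qed

section \<open>The cross energy of an even reflection\<close>

lemma norm_diff_le_norm_diff_reflect:
  assumes "x \<in> halfspace_pos k" "y \<in> halfspace_pos k"
  shows "norm (x - y) \<le> norm (x - reflect k y)"
  using assms by (intro norm_le_componentwise_cart) (auto simp: reflect_nth halfspace_pos_def)

text \<open>
The ball of radius \<open>r\<close> is centred at height \<open>3 r\<close> above the midpoint of \<open>x\<close> and \<open>y\<close>, where \<open>r\<close> dominates
both the distance of \<open>x\<close> and \<open>y\<close> and their heights. Hence \<open>z - x\<close> has length at most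
\<open>r/2 + 3r + r\<close> and vertical component at least \<open>3r - r/2 - r\<close>.
\<close>

lemma lifted_ball_geometry:
  fixes x y z :: "real ^ 'n::finite"
  assumes x: "x \<in> halfspace_pos k" and y: "y \<in> halfspace_pos k"
    and r: "r = norm (x - reflect k y)"
    and z: "norm (z - ((1/2) *\<^sub>R (x + y) + (3 * r) *\<^sub>R axis k 1)) \<le> r"
  shows "z - x \<in> up_cone k" "x $ k \<le> norm (z - x)" "norm (x - y) \<le> norm (z - x)"
    "norm (z - x) \<le> 9/2 * r" "r > 0"
proof -
  define c where "c = (1/2) *\<^sub>R (x + y) + (3 * r) *\<^sub>R axis k (1::real)"
  have xy: "norm (x - y) \<le> r" using norm_diff_le_norm_diff_reflect[OF x y] r by simp
  have "x $ k + y $ k \<le> r"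
    using component_le_norm_cart[of "x - reflect k y" k] r by (simp add: reflect_nth)
  then have xr: "x $ k < r" and r0: "r > 0" using x y by (auto simp: halfspace_pos_def)
  have d: "z - x = (z - c) + (1/2) *\<^sub>R (y - x) + (3 * r) *\<^sub>R axis k 1"
    by (simp add: c_def algebra_simps vec_eq_iff)
  have "norm (z - x) \<le> norm (z - c) + norm ((1/2) *\<^sub>R (y - x)) + norm ((3 * r) *\<^sub>R axis k (1::real))"
    unfolding d by (intro order_trans[OF norm_triangle_ineq] add_mono norm_triangle_ineq) simp
  also have "\<dots> \<le> 9/2 * r" using z xy r0 by (simp add: c_def norm_minus_commute)
  finally show ub: "norm (z - x) \<le> 9/2 * r" .
  have "\<bar>(z - c) $ k\<bar> \<le> r" using component_le_norm_cart[of "z - c" k] z by (simp add: c_def)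
  moreover have "\<bar>(y - x) $ k\<bar> \<le> r" using component_le_norm_cart[of "y - x" k] xy by (simp add: norm_minus_commute)
  moreover have "(z - x) $ k = (z - c) $ k + (1/2) * (y - x) $ k + 3 * r"
    unfolding d by (simp add: axis_def)
  ultimately have lb: "(z - x) $ k \<ge> 3/2 * r" by linarith
  then show "z - x \<in> up_cone k" using ub by (simp add: up_cone_def)
  have "norm (z - x) \<ge> r" using component_le_norm_cart[of "z - x" k] lb r0 by linarith
  then show "x $ k \<le> norm (z - x)" "norm (x - y) \<le> norm (z - x)" using xr xy by auto
  show "r > 0" by fact
qed

lemma ennreal_mult_left_cancel: "0 < w \<Longrightarrow> ennreal w * a \<le> ennreal w * b \<Longrightarrow> a \<le> b"
  by (simp add: ennreal_mult_le_mult_iff)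

lemma square_diff_le: "(a - b)\<^sup>2 \<le> 2 * (c - a)\<^sup>2 + 2 * (c - b)\<^sup>2" for a b c :: real
  using zero_le_power2[of "(c - a) + (c - b)"] by (simp add: power2_eq_square algebra_simps)

text \<open>
Each pair \<open>(x, y)\<close> is compared with all points \<open>z\<close> of the lifted ball; the average over the ball of
\<open>(v z - v x)\<^sup>2 + (v z - v y)\<^sup>2\<close> dominates \<open>(v x - v y)\<^sup>2 / 2\<close>. Both terms contribute equally by symmetry,
and for fixed \<open>x\<close> and \<open>z\<close> the admissible \<open>y\<close> fill at most the ball about \<open>x\<close> through \<open>z\<close>, whose volume
restores the kernel \<open>norm (z - x) powr (- q)\<close>.
\<close>

lemma reflected_gagliardo_le_cone_energy:
  fixes v :: "real ^ 'n::finite \<Rightarrow> real"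
  assumes [measurable]: "v \<in> borel_measurable borel" and q: "q \<ge> 0"
  shows "reflected_gagliardo k q v \<le> ennreal (4 * (9/2) powr (q + CARD('n))) * cone_energy k q v 0 1"
proof -
  let ?H = "halfspace_pos k"
  define n where "n = CARD('n)"
  define p where "p = q + real n"
  have p: "p > 0" using q by (simp add: p_def n_def add_nonneg_pos)
  define \<omega> where "\<omega> = unit_ball_vol (real n)"
  have \<omega>: "\<omega> > 0" by (simp add: \<omega>_def)
  define A where "A = (9/2::real) powr p"
  have A: "A > 0" by (simp add: A_def)
  \<comment> \<open>The condition on \<open>y\<close> keeps the integral of \<open>F\<close> over \<open>y\<close> finite after \<open>y\<close> has left the integrand.\<close>
  define F where "F x y z = (if x \<in> ?H \<and> z - x \<in> up_cone k \<and> x $ k \<le> norm (z - x) \<and> y \<in> cball x (norm (z - x))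
      then ennreal ((v z - v x)\<^sup>2 * norm (z - x) powr (- p)) else 0)" for x y z
  have Fm [measurable]: "(\<lambda>w. F (f w) (g w) (h w)) \<in> borel_measurable M"
    if [measurable]: "f \<in> borel_measurable M" "g \<in> borel_measurable M" "h \<in> borel_measurable M" for f g h M
    unfolding F_def mem_cball by measurable
  have pt: "ennreal \<omega> * (ennreal ((v x - v y)\<^sup>2 / norm (x - reflect k y) powr q) * indicator ?H x * indicator ?H y)
      \<le> ennreal (2 * A) * ((\<integral>\<^sup>+z. F x y z \<partial>lborel) + (\<integral>\<^sup>+z. F y x z \<partial>lborel))" (is "_ * ?l \<le> ?R") for x y
  proof (cases "x \<in> ?H \<and> y \<in> ?H")
    case True
    define r where "r = norm (x - reflect k y)"
    define c where "c = (1/2) *\<^sub>R (x + y) + (3 * r) *\<^sub>R axis k (1::real)"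
    have r': "r = norm (y - reflect k x)"
      using norm_reflect[of k "x - reflect k y"] by (simp add: r_def reflect_diff[symmetric] norm_minus_commute)
    have c': "c = (1/2) *\<^sub>R (y + x) + (3 * r) *\<^sub>R axis k (1::real)" by (simp add: c_def add.commute)
    have r0: "r > 0" using lifted_ball_geometry(5)[of x k y r c] True r_def c_def
      by (metis diff_self norm_ge_zero norm_zero)
    have "ennreal \<omega> * ?l = ennreal (\<omega> * ((v x - v y)\<^sup>2 / r powr q))"
      using True \<omega> by (simp add: r_def flip: ennreal_mult)
    also have "\<omega> * ((v x - v y)\<^sup>2 / r powr q) = ((v x - v y)\<^sup>2 * r powr (- p)) * (\<omega> * r ^ n)"
      using r0 by (simp add: p_def powr_diff powr_minus powr_realpow powr_add divide_inverse)
    also have "ennreal \<dots> = ennreal ((v x - v y)\<^sup>2 * r powr (- p)) * emeasure lborel (cball c r)"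
      using r0 \<omega> by (subst emeasure_cball) (auto simp: ennreal_mult \<omega>_def n_def)
    also have "\<dots> = (\<integral>\<^sup>+z. ennreal ((v x - v y)\<^sup>2 * r powr (- p)) * indicator (cball c r) z \<partial>lborel)"
      by (rule nn_integral_cmult_indicator[symmetric]) simp
    also have "\<dots> \<le> (\<integral>\<^sup>+z. ennreal (2 * A) * (F x y z + F y x z) \<partial>lborel)"
    proof (intro nn_integral_mono, goal_cases)
      case (1 z)
      show ?case
      proof (cases "z \<in> cball c r")
        case z: True
        then have z': "norm (z - c) \<le> r" by (simp add: dist_norm norm_minus_commute)
        note gx = lifted_ball_geometry[OF _ _ r_def z'[unfolded c_def], OF conjunct1[OF True] conjunct2[OF True]]
        note gy = lifted_ball_geometry[OF _ _ r' z'[unfolded c'], OF conjunct2[OF True] conjunct1[OF True]]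
        have rp: "r powr (- p) \<le> A * norm (z - x) powr (- p)" if "norm (z - x) \<le> 9/2 * r" "norm (z - x) > 0" for x
        proof -
          have "((9/2) * r) powr (- p) \<le> norm (z - x) powr (- p)"
            using that p by (intro powr_mono2') auto
          then have "A * (((9/2) * r) powr (- p)) \<le> A * norm (z - x) powr (- p)" using A by (intro mult_left_mono) auto
          moreover have "A * (((9/2) * r) powr (- p)) = r powr (- p)"
            using r0 unfolding A_def by (subst powr_mult) (auto simp: mult.assoc[symmetric] powr_add[symmetric])
          ultimately show ?thesis by simp
        qed
        have nz: "norm (z - x) > 0" "norm (z - y) > 0"
          using gx(2) gy(2) True by (auto simp: halfspace_pos_def simp del: zero_less_norm_iff)
        have "(v x - v y)\<^sup>2 * r powr (- p) \<le> (2 * (v z - v x)\<^sup>2 + 2 * (v z - v y)\<^sup>2) * r powr (- p)"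
          by (intro mult_right_mono square_diff_le) auto
        also have "\<dots> = 2 * ((v z - v x)\<^sup>2 * r powr (- p)) + 2 * ((v z - v y)\<^sup>2 * r powr (- p))"
          by (simp add: algebra_simps)
        also have "\<dots> \<le> 2 * ((v z - v x)\<^sup>2 * (A * norm (z - x) powr (- p))) + 2 * ((v z - v y)\<^sup>2 * (A * norm (z - y) powr (- p)))"
          using rp[OF gx(4) nz(1)] rp[OF gy(4) nz(2)] by (intro add_mono mult_left_mono) auto
        also have "\<dots> = (2 * A) * ((v z - v x)\<^sup>2 * norm (z - x) powr (- p) + (v z - v y)\<^sup>2 * norm (z - y) powr (- p))"
          by (simp add: algebra_simps)
        finally have "ennreal ((v x - v y)\<^sup>2 * r powr (- p)) \<le> ennreal (2 * A) *
            (ennreal ((v z - v x)\<^sup>2 * norm (z - x) powr (- p)) + ennreal ((v z - v y)\<^sup>2 * norm (z - y) powr (- p)))"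
          using A by (subst ennreal_plus[symmetric], simp, simp, subst ennreal_mult[symmetric]) (auto intro: ennreal_leI)
        also have "\<dots> = ennreal (2 * A) * (F x y z + F y x z)"
          using True gx gy by (simp add: F_def dist_norm norm_minus_commute[of y x])
        finally show ?thesis using z by simp
      qed simp
    qed
    also have "\<dots> = ?R"
      by (simp add: nn_integral_cmult nn_integral_add)
    finally show ?thesis .
  qed auto
  have F_total: "(\<integral>\<^sup>+x. \<integral>\<^sup>+y. \<integral>\<^sup>+z. F x y z \<partial>lborel \<partial>lborel \<partial>lborel) = ennreal \<omega> * cone_energy k q v 0 1"
  proof -
    let ?G = "\<lambda>x g. if g \<in> up_cone k then ennreal (norm g powr (- q)) *
              (if 0 < x $ k \<and> x $ k \<le> norm g then ennreal ((v (x + g) - v x)\<^sup>2) else 0) else 0"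
    have "(\<integral>\<^sup>+x. \<integral>\<^sup>+y. \<integral>\<^sup>+z. F x y z \<partial>lborel \<partial>lborel \<partial>lborel) = (\<integral>\<^sup>+x. \<integral>\<^sup>+z. \<integral>\<^sup>+y. F x y z \<partial>lborel \<partial>lborel \<partial>lborel)"
      by (intro nn_integral_cong nn_integral_lborel_swap) measurable
    also have "\<dots> = (\<integral>\<^sup>+x. \<integral>\<^sup>+g. \<integral>\<^sup>+y. F x y (g + x) \<partial>lborel \<partial>lborel \<partial>lborel)"
      by (intro nn_integral_cong nn_integral_lborel_translate[symmetric]) measurable
    also have "\<dots> = (\<integral>\<^sup>+x. \<integral>\<^sup>+g. ennreal \<omega> * ?G x g \<partial>lborel \<partial>lborel)"
    proof (intro nn_integral_cong)
      fix x g :: "real ^ 'n"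
      have "(\<integral>\<^sup>+y. F x y (g + x) \<partial>lborel) = (\<integral>\<^sup>+y. (if x \<in> ?H \<and> g \<in> up_cone k \<and> x $ k \<le> norm g
          then ennreal ((v (x + g) - v x)\<^sup>2 * norm g powr (- p)) else 0) * indicator (cball x (norm g)) y \<partial>lborel)"
        by (intro nn_integral_cong) (auto simp: F_def add.commute)
      also have "\<dots> = (if x \<in> ?H \<and> g \<in> up_cone k \<and> x $ k \<le> norm g
          then ennreal ((v (x + g) - v x)\<^sup>2 * norm g powr (- p)) else 0) * ennreal (\<omega> * norm g ^ n)"
        by (subst nn_integral_cmult_indicator) (auto simp: emeasure_cball \<omega>_def n_def)
      also have "\<dots> = ennreal \<omega> * ?G x g"
      proof (cases "x \<in> ?H \<and> g \<in> up_cone k \<and> x $ k \<le> norm g")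
        case True
        then have "norm g > 0" by (auto simp: halfspace_pos_def simp del: zero_less_norm_iff)
        then have "norm g powr (- p) * norm g ^ n = norm g powr (- q)"
          by (simp add: p_def powr_diff powr_realpow powr_add[symmetric] powr_minus flip: powr_realpow)
        then have "((v (x + g) - v x)\<^sup>2 * norm g powr (- p)) * (\<omega> * norm g ^ n) = \<omega> * (norm g powr (- q) * (v (x + g) - v x)\<^sup>2)"
          by (metis mult.assoc mult.commute)
        then show ?thesis using True \<omega> by (simp add: halfspace_pos_def flip: ennreal_mult)
      qed (auto simp: halfspace_pos_def)
      finally show "(\<integral>\<^sup>+y. F x y (g + x) \<partial>lborel) = ennreal \<omega> * ?G x g" .
    qed
    also have "\<dots> = ennreal \<omega> * (\<integral>\<^sup>+x. \<integral>\<^sup>+g. ?G x g \<partial>lborel \<partial>lborel)"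
      by (simp add: nn_integral_cmult)
    also have "(\<integral>\<^sup>+x. \<integral>\<^sup>+g. ?G x g \<partial>lborel \<partial>lborel) = (\<integral>\<^sup>+g. \<integral>\<^sup>+x. ?G x g \<partial>lborel \<partial>lborel)"
      by (rule nn_integral_lborel_swap) measurable
    also have "\<dots> = cone_energy k q v 0 1"
      unfolding cone_energy_def slab_diff_def by (intro nn_integral_cong) (simp add: nn_integral_cmult)
    finally show ?thesis .
  qed
  have F_total': "(\<integral>\<^sup>+x. \<integral>\<^sup>+y. \<integral>\<^sup>+z. F y x z \<partial>lborel \<partial>lborel \<partial>lborel) = ennreal \<omega> * cone_energy k q v 0 1"
    by (subst nn_integral_lborel_swap) (auto simp: F_total)
  have "ennreal \<omega> * reflected_gagliardo k q v \<le> (\<integral>\<^sup>+x. \<integral>\<^sup>+y. ennreal (2 * A) * ((\<integral>\<^sup>+z. F x y z \<partial>lborel) + (\<integral>\<^sup>+z. F y x z \<partial>lborel)) \<partial>lborel \<partial>lborel)"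
    unfolding reflected_gagliardo_def using pt
    by (simp add: nn_integral_cmult[symmetric] nn_integral_mono)
  also have "\<dots> = ennreal (2 * A) * ((\<integral>\<^sup>+x. \<integral>\<^sup>+y. \<integral>\<^sup>+z. F x y z \<partial>lborel \<partial>lborel \<partial>lborel) + (\<integral>\<^sup>+x. \<integral>\<^sup>+y. \<integral>\<^sup>+z. F y x z \<partial>lborel \<partial>lborel \<partial>lborel))"
    by (simp add: nn_integral_cmult nn_integral_add)
  also have "\<dots> = ennreal \<omega> * (ennreal (4 * A) * cone_energy k q v 0 1)"
  proof -
    have "ennreal (4 * A) * X = ennreal (2 * A) * (2 * X)" for X
      using ennreal_double[of "2 * A" X] A by simp
    then show ?thesis unfolding F_total F_total' mult_2[symmetric]
      by (simp only: mult.left_commute[of "ennreal \<omega>"])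
  qed
  finally show ?thesis
    unfolding A_def p_def n_def by (rule ennreal_mult_left_cancel[OF \<omega>])
qed

text \<open>
The range \<open>(1/3, 3]\<close> is compared with the ranges \<open>(12^j/3, 4 * 12^j]\<close>. These are disjoint because
\<open>4 * 12^j = 12^(j+1)/3\<close>, so their energies sum to at most the energy in the halfspace.
\<close>

lemma cone_energy_le_bands:
  fixes v :: "real ^ 'n::finite \<Rightarrow> real"
  assumes [measurable]: "v \<in> borel_measurable borel" and s: "s \<le> 1"
  defines "q \<equiv> real CARD('n) + 2 * s"
  shows "of_nat J * cone_energy k q v (1/3) 3
    \<le> ennreal (12 powr (real J * (2 - 2 * s))) * gagliardo q v (halfspace_pos k) (halfspace_pos k)"
proof -
  have "of_nat J * cone_energy k q v (1/3) 3 = (\<Sum>j<J. cone_energy k q v (1/3) 3)" by simp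
  also have "\<dots> \<le> (\<Sum>j<J. ennreal (12 powr (real J * (2 - 2 * s))) * cone_energy k q v (12 ^ j / 3) (4 * 12 ^ j))"
  proof (intro sum_mono)
    fix j assume j: "j \<in> {..<J}"
    have "cone_energy k q v (1/3) 3 \<le> ennreal (real (12 ^ j) powr (2 + real CARD('n) - q)) * cone_energy k q v (real (12 ^ j) / 3) (4 * real (12 ^ j))"
      by (rule cone_energy_descend) auto
    also have "real (12 ^ j) powr (2 + real CARD('n) - q) = 12 powr (real j * (2 - 2 * s))"
      by (simp add: q_def powr_powr flip: powr_realpow)
    also have "ennreal (12 powr (real j * (2 - 2 * s))) * cone_energy k q v (real (12 ^ j) / 3) (4 * real (12 ^ j))
        \<le> ennreal (12 powr (real J * (2 - 2 * s))) * cone_energy k q v (12 ^ j / 3) (4 * 12 ^ j)"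
      using j s by (simp, intro mult_right_mono ennreal_leI powr_mono) (auto intro!: mult_right_mono)
    finally show "cone_energy k q v (1/3) 3 \<le> ennreal (12 powr (real J * (2 - 2 * s))) * cone_energy k q v (12 ^ j / 3) (4 * 12 ^ j)" .
  qed
  also have "\<dots> = ennreal (12 powr (real J * (2 - 2 * s))) * (\<Sum>j<J. cone_energy k q v (12 ^ j / 3) (4 * 12 ^ j))"
    by (simp add: sum_distrib_left)
  also have "\<dots> \<le> ennreal (12 powr (real J * (2 - 2 * s))) * gagliardo q v (halfspace_pos k) (halfspace_pos k)"
  proof (intro mult_left_mono cone_energy_bands_le)
    have "4 * 12 ^ i \<le> (12::real) ^ j / 3" if "i < j" for i j :: nat
      using power_increasing[of "Suc i" j "12::real"] that by simp
    then show "4 * 12 ^ i \<le> (12::real) ^ j / 3 \<or> 4 * 12 ^ j \<le> (12::real) ^ i / 3" if "i \<noteq> j" for i j :: nat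
      using that by (meson linorder_neqE_nat)
  qed auto
  finally show ?thesis .
qed

lemma reflected_gagliardo_bound:
  fixes v :: "real ^ 'n::finite \<Rightarrow> real"
  assumes [measurable]: "v \<in> borel_measurable borel" and s: "3/4 \<le> s" "s \<le> 1" and J: "J > 0"
  defines "q \<equiv> real CARD('n) + 2 * s"
  assumes fin: "gagliardo q v (halfspace_pos k) (halfspace_pos k) < \<infinity>"
  shows "reflected_gagliardo k q v \<le> ennreal (24 * (9/2) powr (2 * real CARD('n) + 2) * 12 powr (real J * (2 - 2 * s)) / real J)
           * gagliardo q v (halfspace_pos k) (halfspace_pos k)"
proof -
  let ?G = "gagliardo q v (halfspace_pos k) (halfspace_pos k)"
  have P_le: "cone_energy k q v 0 1 \<le> ?G"
    using cone_energy_bands_le[of v "{()}" "\<lambda>_. 1" "\<lambda>_. 0" k q] by simp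
  have S_le: "cone_energy k q v (1/3) 3 \<le> ?G"
    using cone_energy_bands_le[of v "{()}" "\<lambda>_. 3" "\<lambda>_. 1/3" k q] by simp
  obtain P where P: "cone_energy k q v 0 1 = ennreal P" "P \<ge> 0"
    using le_less_trans[OF P_le fin] by (cases "cone_energy k q v 0 1") auto
  obtain S where S: "cone_energy k q v (1/3) 3 = ennreal S" "S \<ge> 0"
    using le_less_trans[OF S_le fin] by (cases "cone_energy k q v (1/3) 3") auto
  obtain G where G: "?G = ennreal G" "G \<ge> 0"
    using fin by (cases ?G) auto
  define E where "E = 12 powr (real J * (2 - 2 * s))"
  have E: "E > 0" by (simp add: E_def)
  have "cone_energy k q v 0 1 \<le> ennreal (2 * 2 powr (real CARD('n) - q)) *
           (cone_energy k q v 0 1 + 2 * cone_energy k q v (1/3) 3)"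
    by (rule cone_energy_midpoint) fact
  also have "\<dots> = ennreal (2 * 2 powr (- (2 * s)) * (P + 2 * S))"
    using P S by (simp add: q_def ennreal_mult ennreal_plus)
  finally have "P \<le> 2 * 2 powr (- (2 * s)) * (P + 2 * S)"
    using P S by (simp add: ennreal_le_iff)
  \<comment> \<open>The factor stays below 1, so that \<open>P\<close> can be absorbed; this uses that \<open>P\<close> is finite.\<close>
  also have "\<dots> \<le> 3/4 * (P + 2 * S)"
  proof (rule mult_right_mono)
    have "2 powr (- (2 * s)) \<le> 2 powr (- (3/2) :: real)" using s by (intro powr_mono) auto
    also have "\<dots> \<le> 3/8"
    proof (rule power2_le_imp_le)
      have "(2 powr (- (3/2) :: real))\<^sup>2 = 2 powr (- 3)"
        by (simp add: powr_powr flip: powr_realpow)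
      also have "\<dots> = 1/8" by (simp add: powr_minus)
      finally show "(2 powr (- (3/2) :: real))\<^sup>2 \<le> (3/8)\<^sup>2" by (simp add: power2_eq_square)
    qed simp
    finally show "2 * 2 powr (- (2 * s)) \<le> 3/4" by simp
  qed (use P S in auto)
  finally have PS: "P \<le> 6 * S" by simp
  have "ennreal (real J * S) = of_nat J * cone_energy k q v (1/3) 3"
    using S by (simp add: ennreal_mult ennreal_of_nat_eq_real_of_nat)
  also have "\<dots> \<le> ennreal E * ?G"
    unfolding q_def E_def by (rule cone_energy_le_bands) (use s in auto)
  also have "\<dots> = ennreal (E * G)" using G E by (simp add: ennreal_mult)
  finally have "real J * S \<le> E * G" using G E by (simp add: ennreal_le_iff)
  then have "S \<le> E * G / real J" using J by (simp add: field_simps)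
  with PS have PG: "P \<le> 6 * (E * G / real J)" by linarith
  have "reflected_gagliardo k q v \<le> ennreal (4 * (9/2) powr (q + CARD('n))) * ennreal P"
    using reflected_gagliardo_le_cone_energy[of v q k] s P by (simp add: q_def)
  also have "\<dots> = ennreal (4 * (9/2) powr (q + CARD('n)) * P)" by (simp add: ennreal_mult P)
  also have "\<dots> \<le> ennreal (4 * (9/2) powr (2 * real CARD('n) + 2) * (6 * (E * G / real J)))"
    using s PG P by (intro ennreal_leI mult_mono powr_mono) (auto simp: q_def)
  also have "\<dots> = ennreal ((24 * (9/2) powr (2 * real CARD('n) + 2) * E / real J) * G)"
    by (simp add: mult_ac)
  also have "\<dots> = ennreal (24 * (9/2) powr (2 * real CARD('n) + 2) * E / real J) * ?G"
    unfolding G by (rule ennreal_mult) (use G E in auto)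
  finally show ?thesis by (simp add: E_def)
qed

text \<open>
In \<open>reflected_gagliardo_bound\<close> the number \<open>J\<close> of scales is chosen first, to make \<open>C / J\<close> small; then \<open>s\<close> is taken
so close to 1 that the loss \<open>12 powr (J (2 - 2s))\<close> does not exceed 2.
\<close>

lemma reflected_gagliardo_small:
  assumes "\<eta> > 0"
  obtains s0 where "0 < s0" "s0 < 1"
    "\<And>s (v :: real ^ 'n::finite \<Rightarrow> real) k. s0 < s \<Longrightarrow> s < 1 \<Longrightarrow> v \<in> borel_measurable borel \<Longrightarrow>
       gagliardo (real CARD('n) + 2 * s) v (halfspace_pos k) (halfspace_pos k) < \<infinity> \<Longrightarrow>
       reflected_gagliardo k (real CARD('n) + 2 * s) v
         \<le> ennreal \<eta> * gagliardo (real CARD('n) + 2 * s) v (halfspace_pos k) (halfspace_pos k)"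
proof -
  define C where "C = 24 * (9/2) powr (2 * real CARD('n) + 2)"
  have C: "C > 0" by (simp add: C_def)
  obtain J0 :: nat where J0: "2 * C / \<eta> < real J0" using reals_Archimedean2 by blast
  define J where "J = Suc J0"
  have J: "J > 0" "2 * C / \<eta> < real J" using J0 by (auto simp: J_def)
  \<comment> \<open>For \<open>s > s0\<close> the exponent \<open>J (2 - 2s)\<close> is below \<open>1/4\<close>, and \<open>12 powr (1/4) < 2\<close>.\<close>
  define s0 where "s0 = 1 - 1 / (8 * real J)"
  have s0: "3/4 < s0" "s0 < 1" using J by (auto simp: s0_def field_simps)
  show ?thesis
  proof (rule that[of s0])
    fix s and v :: "real ^ 'n::finite \<Rightarrow> real" and k
    assume s: "s0 < s" "s < 1" and v: "v \<in> borel_measurable borel"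
      and fin: "gagliardo (real CARD('n) + 2 * s) v (halfspace_pos k) (halfspace_pos k) < \<infinity>"
    have "real J * (2 - 2 * s) \<le> real J * (1 / (4 * real J))"
      using s J by (intro mult_left_mono) (auto simp: s0_def)
    also have "\<dots> = 1/4" using J by simp
    finally have "12 powr (real J * (2 - 2 * s)) \<le> 16 powr (1/4 :: real)"
      by (intro order_trans[OF powr_mono powr_mono2]) auto
    also have "(16::real) powr (1/4) = 2"
      using powr_powr[of "2::real" 4 "1/4"] by simp
    finally have "C * 12 powr (real J * (2 - 2 * s)) / real J \<le> C * 2 / real J"
      using C by (intro divide_right_mono mult_left_mono) auto
    also have "\<dots> \<le> \<eta>" using J \<open>\<eta> > 0\<close> by (simp add: field_simps)
    finally have le: "C * 12 powr (real J * (2 - 2 * s)) / real J \<le> \<eta>" .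
    have "reflected_gagliardo k (real CARD('n) + 2 * s) v
       \<le> ennreal (C * 12 powr (real J * (2 - 2 * s)) / real J) * gagliardo (real CARD('n) + 2 * s) v (halfspace_pos k) (halfspace_pos k)"
      unfolding C_def by (rule reflected_gagliardo_bound[OF v]) (use s s0 J fin in auto)
    also have "\<dots> \<le> ennreal \<eta> * gagliardo (real CARD('n) + 2 * s) v (halfspace_pos k) (halfspace_pos k)"
      by (intro mult_right_mono ennreal_leI le) simp
    finally show "reflected_gagliardo k (real CARD('n) + 2 * s) v
       \<le> ennreal \<eta> * gagliardo (real CARD('n) + 2 * s) v (halfspace_pos k) (halfspace_pos k)" .
  qed (use s0 in auto)
qed

section \<open>A function of finite energy\<close>

lemma cball_measurable [measurable]: "cball c r \<in> sets borel" for c :: "'a::euclidean_space"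
  by simp

lemma dyadic_bracket: "\<exists>j::nat. 2 ^ j \<le> t \<and> t < 2 ^ Suc j" if "1 \<le> t" for t :: real
proof -
  define N where "N = (LEAST N. t < 2 ^ N)"
  have ex: "\<exists>N. t < 2 ^ N" by (rule real_arch_pow) simp
  have N: "t < 2 ^ N" unfolding N_def using ex by (rule LeastI_ex)
  with that have "N \<noteq> 0" by (intro notI) simp
  then obtain j where j: "N = Suc j" by (cases N) auto
  have "\<not> t < 2 ^ j" using not_less_Least[of j "\<lambda>N. t < 2 ^ N"] j unfolding N_def by simp
  with N j show ?thesis by (intro exI[of _ j]) auto
qed

text \<open>
The kernel is compared with a geometric sum over dyadic shells. The sum over large \<open>h\<close> has ratio
\<open>2 powr (-2s)\<close> and the sum over small \<open>h\<close> has ratio \<open>2 powr (2s - 2)\<close>.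
\<close>

lemma nn_integral_truncated_kernel_finite:
  fixes s :: real
  assumes s: "0 < s" "s < 1"
  defines "q \<equiv> real CARD('n::finite) + 2 * s"
  shows "(\<integral>\<^sup>+h. ennreal (min 1 ((norm h)\<^sup>2) / norm h powr q) \<partial>(lborel :: (real ^ 'n) measure)) < \<infinity>"
proof -
  define n where "n = CARD('n)"
  define \<omega> where "\<omega> = unit_ball_vol (real n)"
  have \<omega>: "\<omega> > 0" by (simp add: \<omega>_def)
  have q: "q > 0" "q > real n" using s by (auto simp: q_def n_def add_nonneg_pos)
  define a where "a j = (1 / 2 ^ j) powr q" for j :: nat
  define b where "b j = 2 powr q * ((2 ^ j) powr q * (1 / 2 ^ j)\<^sup>2)" for j :: nat
  define f where "f j h = ennreal (a j) * indicator (cball (0::real^'n) (2 ^ Suc j)) h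
       + ennreal (b j) * indicator (cball (0::real^'n) (1 / 2 ^ j)) h" for j h
  have [measurable]: "f j \<in> borel_measurable borel" for j unfolding f_def by measurable
  have pt: "ennreal (min 1 ((norm h)\<^sup>2) / norm h powr q) \<le> (\<Sum>j. f j h)" for h :: "real ^ 'n"
  proof (cases "h = 0")
    case False
    define t where "t = norm h"
    have t: "t > 0" using False by (simp add: t_def)
    have "\<exists>j. ennreal (min 1 (t\<^sup>2) / t powr q) \<le> f j h"
    proof (cases "t \<ge> 1")
      case True
      then obtain j where j: "2 ^ j \<le> t" "t < 2 ^ Suc j" using dyadic_bracket by blast
      have "min 1 (t\<^sup>2) / t powr q \<le> 1 / t powr q"
        using t by (intro divide_right_mono) auto
      also have "\<dots> \<le> 1 / (2 ^ j) powr q" using j t q by (intro divide_left_mono powr_mono2) auto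
      also have "\<dots> = a j" by (simp add: a_def powr_divide)
      finally have "ennreal (min 1 (t\<^sup>2) / t powr q) \<le> ennreal (a j)" by (rule ennreal_leI)
      also have "\<dots> \<le> f j h" using j by (simp add: f_def t_def)
      finally show ?thesis by blast
    next
      case False
      then obtain j where j: "2 ^ j \<le> 1 / t" "1 / t < 2 ^ Suc j" using dyadic_bracket[of "1 / t"] t by auto
      have tj: "t \<le> 1 / 2 ^ j" using j(1) t by (simp add: field_simps)
      have tj': "1 / (2 * 2 ^ j) \<le> t" using j(2) t by (simp add: field_simps)
      have "min 1 (t\<^sup>2) / t powr q \<le> t\<^sup>2 / t powr q"
        using t by (intro divide_right_mono) auto
      also have "\<dots> \<le> (1 / 2 ^ j)\<^sup>2 / (1 / (2 * 2 ^ j)) powr q"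
        using t q tj tj' by (intro frac_le powr_mono2 power_mono) auto
      also have "\<dots> = b j" by (simp add: b_def powr_divide powr_mult field_simps)
      finally have "ennreal (min 1 (t\<^sup>2) / t powr q) \<le> ennreal (b j)" by (rule ennreal_leI)
      also have "\<dots> \<le> f j h" using tj by (simp add: f_def t_def)
      finally show ?thesis by blast
    qed
    then obtain j where "ennreal (min 1 (t\<^sup>2) / t powr q) \<le> f j h" by blast
    also have "\<dots> \<le> (\<Sum>j. f j h)"
      using sum_le_suminf[of "\<lambda>j. f j h" "{j}"] by simp
    finally show ?thesis by (simp add: t_def)
  qed simp
  define c where "c j = \<omega> * 2 ^ n * (2 powr (- (2 * s))) ^ j + \<omega> * 2 powr q * (2 powr (2 * s - 2)) ^ j" for j :: nat
  have p2: "(2 ^ j) powr x = (2 powr x) ^ j" for x :: real and j :: nat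
    by (simp add: powr_power flip: powr_realpow) (simp add: powr_powr mult.commute)
  have int: "(\<integral>\<^sup>+h. f j h \<partial>lborel) = ennreal (c j)" for j
  proof -
    have "(\<integral>\<^sup>+h. f j h \<partial>lborel) = ennreal (a j) * ennreal (\<omega> * (2 ^ Suc j) ^ n) + ennreal (b j) * ennreal (\<omega> * (1 / 2 ^ j) ^ n)"
      unfolding f_def
      by (subst nn_integral_add, measurable) (simp add: nn_integral_cmult_indicator emeasure_cball \<omega>_def n_def)
    also have "\<dots> = ennreal (a j * (\<omega> * (2 ^ Suc j) ^ n) + b j * (\<omega> * (1 / 2 ^ j) ^ n))"
      using \<omega> by (subst ennreal_plus) (auto simp: ennreal_mult a_def b_def)
    also have "a j * (\<omega> * (2 ^ Suc j) ^ n) = \<omega> * 2 ^ n * (2 powr (- (2 * s))) ^ j"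
    proof -
      have "a j * (2 ^ j) ^ n = (2 ^ j) powr (- q) * (2 ^ j) powr (real n)"
        by (simp add: a_def powr_minus powr_realpow divide_inverse inverse_powr)
      also have "\<dots> = (2 powr (- (2 * s))) ^ j"
        by (simp add: powr_add[symmetric] q_def n_def p2[symmetric])
      finally show ?thesis by (simp add: power_mult_distrib mult_ac)
    qed
    also have "b j * (\<omega> * (1 / 2 ^ j) ^ n) = \<omega> * 2 powr q * (2 powr (2 * s - 2)) ^ j"
    proof -
      have "(2 ^ j) powr q * (1 / 2 ^ j)\<^sup>2 * (1 / 2 ^ j) ^ n = (2 ^ j) powr q * (2 ^ j) powr (- 2) * (2 ^ j) powr (- real n)"
        by (simp add: powr_minus powr_realpow power_inverse divide_inverse)
      also have "\<dots> = (2 powr (2 * s - 2)) ^ j"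
        by (simp add: powr_add[symmetric] q_def n_def p2[symmetric])
      finally show ?thesis by (simp add: b_def mult_ac)
    qed
    finally show ?thesis by (simp add: c_def)
  qed
  have "2 powr (- (2 * s)) < 2 powr 0" "2 powr (2 * s - 2) < 2 powr 0"
    using s by (intro powr_less_mono; simp)+
  then have sm: "summable c"
    unfolding c_def by (intro summable_add summable_mult summable_geometric) auto
  have "(\<integral>\<^sup>+h. ennreal (min 1 ((norm h)\<^sup>2) / norm h powr q) \<partial>(lborel :: (real ^ 'n) measure)) \<le> (\<integral>\<^sup>+h. (\<Sum>j. f j h) \<partial>lborel)"
    by (intro nn_integral_mono pt)
  also have "\<dots> = (\<Sum>j. ennreal (c j))"
    by (subst nn_integral_suminf) (auto simp: int)
  also have "\<dots> = ennreal (\<Sum>j. c j)"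
    using \<omega> by (intro suminf_ennreal2 sm) (simp add: c_def)
  also have "\<dots> < \<infinity>" by simp
  finally show ?thesis .
qed

text \<open>
The difference \<open>v x - v y\<close> is at most the smaller of 1 and \<open>norm (x - y)\<close>, and it vanishes unless one
of the points is in the unit ball.
\<close>

lemma gagliardo_bump_finite:
  fixes s :: real
  assumes s: "0 < s" "s < 1"
  shows "gagliardo (real CARD('n::finite) + 2 * s) (\<lambda>x::real^'n. max 0 (1 - norm x)) UNIV UNIV < \<infinity>"
proof -
  let ?v = "\<lambda>x::real^'n. max 0 (1 - norm x)"
  define q where "q = real CARD('n) + 2 * s"
  let ?K = "\<lambda>h::real^'n. ennreal (min 1 ((norm h)\<^sup>2) / norm h powr q)"
  let ?B = "cball (0::real^'n) 1"
  have pt: "ennreal ((?v x - ?v y)\<^sup>2 / norm (x - y) powr q) \<le> ?K (x - y) * indicator ?B x + ?K (x - y) * indicator ?B y" for x y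
  proof (cases "x \<in> ?B \<or> y \<in> ?B")
    case True
    have "\<bar>?v x - ?v y\<bar> \<le> min 1 (norm (x - y))"
      using norm_triangle_ineq3[of x y] norm_ge_zero[of x] norm_ge_zero[of y] by (auto simp: max_def min_def simp del: norm_ge_zero)
    then have "(?v x - ?v y)\<^sup>2 \<le> (min 1 (norm (x - y)))\<^sup>2" by (metis abs_ge_zero power2_abs power_mono)
    also have "\<dots> \<le> min 1 ((norm (x - y))\<^sup>2)" by (auto simp: min_def power_le_one)
    finally have "ennreal ((?v x - ?v y)\<^sup>2 / norm (x - y) powr q) \<le> ?K (x - y)"
      by (intro ennreal_leI divide_right_mono) auto
    also have "\<dots> \<le> ?K (x - y) * indicator ?B x + ?K (x - y) * indicator ?B y"
      using True by (auto simp: indicator_def)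
    finally show ?thesis .
  next
    case False
    then show ?thesis by simp
  qed
  have "gagliardo q ?v UNIV UNIV \<le> (\<integral>\<^sup>+x. \<integral>\<^sup>+y. ?K (x - y) * indicator ?B x + ?K (x - y) * indicator ?B y \<partial>lborel \<partial>lborel)"
    unfolding gagliardo_def using pt by (intro nn_integral_mono) auto
  also have "\<dots> = (\<integral>\<^sup>+x. \<integral>\<^sup>+y. ?K (x - y) * indicator ?B x \<partial>lborel \<partial>lborel) + (\<integral>\<^sup>+x. \<integral>\<^sup>+y. ?K (x - y) * indicator ?B y \<partial>lborel \<partial>lborel)"
    by (subst nn_integral_add[symmetric], measurable)
       (intro nn_integral_cong nn_integral_add; measurable)
  also have "(\<integral>\<^sup>+x. \<integral>\<^sup>+y. ?K (x - y) * indicator ?B y \<partial>lborel \<partial>lborel) = (\<integral>\<^sup>+y. \<integral>\<^sup>+x. ?K (x - y) * indicator ?B y \<partial>lborel \<partial>lborel)"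
    by (rule nn_integral_lborel_swap) measurable
  also have "\<dots> = (\<integral>\<^sup>+x. \<integral>\<^sup>+y. ?K (x - y) * indicator ?B x \<partial>lborel \<partial>lborel)"
    by (simp add: norm_minus_commute)
  also have "(\<integral>\<^sup>+x. \<integral>\<^sup>+y. ?K (x - y) * indicator ?B x \<partial>lborel \<partial>lborel) = (\<integral>\<^sup>+x. (\<integral>\<^sup>+h. ?K h \<partial>lborel) * indicator ?B x \<partial>lborel)"
  proof (rule nn_integral_cong)
    fix x :: "real ^ 'n"
    have "(\<integral>\<^sup>+y. ?K (x - y) \<partial>lborel) = (\<integral>\<^sup>+h. ?K h \<partial>lborel)"
      using nn_integral_lborel_translate[of "\<lambda>y. ?K (x - y)" x] by simp
    then show "(\<integral>\<^sup>+y. ?K (x - y) * indicator ?B x \<partial>lborel) = (\<integral>\<^sup>+h. ?K h \<partial>lborel) * indicator ?B x"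
      by (simp add: nn_integral_multc)
  qed
  also have "\<dots> = (\<integral>\<^sup>+h. ?K h \<partial>lborel) * emeasure lborel ?B"
    by (rule nn_integral_cmult_indicator) simp
  finally have "gagliardo q ?v UNIV UNIV \<le> (\<integral>\<^sup>+h. ?K h \<partial>lborel) * emeasure lborel ?B + (\<integral>\<^sup>+h. ?K h \<partial>lborel) * emeasure lborel ?B" .
  also have "\<dots> < \<infinity>"
    using nn_integral_truncated_kernel_finite[OF s, where 'n='n]
    by (simp add: q_def emeasure_cball ennreal_mult_less_top)
  finally show ?thesis by (simp add: q_def)
qed

section \<open>The fractional Sobolev inequality\<close>

text \<open>
The arithmetic of \<open>gagliardo_lower_bound\<close>: \<open>T\<close> is half the volume of a ball of radius \<open>r = (2 T / \<omega>) powr (1 / n)\<close>,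
and the exponents are such that the outcome is proportional to \<open>a powr p\<close>.
\<close>

lemma level_set_scaling:
  fixes a M \<omega> n p s :: real
  assumes a: "a > 0" and M: "M > 0" and \<omega>: "\<omega> > 0" and n: "n > 0" and pn: "2 + 2 * s * p / n = p"
  defines "T \<equiv> 2 powr p * M / a powr p"
  shows "1/4 * (2 / \<omega>) powr (- ((n + 2 * s) / n)) * 2 powr (- (2 * s * p / n)) * M powr (- (2 * s / n)) * a powr p
    = a\<^sup>2 / 4 / ((2 * T / \<omega>) powr (1 / n)) powr (n + 2 * s) * T"
proof -
  define e where "e = - (2 * s / n)"
  define d where "d = (n + 2 * s) / n"
  have T: "T > 0" using a M by (simp add: T_def)
  have de: "- d + 1 = e" using n by (simp add: d_def e_def field_simps)
  have pe: "p * e = - (2 * s * p / n)" by (simp add: e_def)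
  have Te: "T powr e = 2 powr (p * e) * M powr e / a powr (p * e)"
    unfolding T_def powr_divide powr_mult powr_powr ..
  have Td: "T powr e = T / T powr d"
  proof -
    have "T powr e = T powr (- d) * T powr 1" by (simp only: powr_add[symmetric] de)
    also have "T powr 1 = T" using T by (intro powr_one) simp
    finally show ?thesis by (simp only: powr_minus divide_inverse mult.commute)
  qed
  have "((2 * T / \<omega>) powr (1 / n)) powr (n + 2 * s) = ((2 / \<omega>) * T) powr d"
    unfolding powr_powr d_def by simp
  also have "\<dots> = (2 / \<omega>) powr d * T powr d" by (rule powr_mult)
  finally have r: "((2 * T / \<omega>) powr (1 / n)) powr (n + 2 * s) = (2 / \<omega>) powr d * T powr d" .
  have "a powr p = a powr 2 * a powr (- (p * e))"
  proof -
    have "2 + - (p * e) = p" unfolding pe minus_minus by (rule pn)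
    then show ?thesis by (simp only: powr_add[symmetric])
  qed
  also have "\<dots> = a\<^sup>2 / a powr (p * e)" using a by (simp add: powr_minus divide_inverse)
  finally have ap: "a powr p = a\<^sup>2 / a powr (p * e)" .
  have "1/4 * (2 / \<omega>) powr (- d) * 2 powr (p * e) * M powr e * a powr p
    = a\<^sup>2 / 4 / (2 / \<omega>) powr d * (2 powr (p * e) * M powr e / a powr (p * e))"
    unfolding ap powr_minus divide_inverse by (simp only: mult_ac mult_1)
  also have "\<dots> = a\<^sup>2 / 4 / ((2 / \<omega>) powr d * T powr d) * T"
    unfolding Te[symmetric] Td by (simp only: divide_inverse inverse_mult_distrib mult_ac)
  finally show ?thesis unfolding r pe unfolding d_def e_def .
qed

text \<open>
Fix \<open>x\<close> with \<open>a = \<bar>v x\<bar> > 0\<close>. By Chebyshev the set where \<open>\<bar>v\<bar> > a/2\<close> has volume at most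
\<open>T = 2 powr p * M / a powr p\<close>. In the ball about \<open>x\<close> of volume \<open>2 T\<close> there remains a set of volume at
least \<open>T\<close> on which \<open>v\<close> differs from \<open>v x\<close> by at least \<open>a/2\<close>. This bounds the inner integral at \<open>x\<close> from below
by a multiple of \<open>M powr (-2s/n) * a powr p\<close>, and integrating in \<open>x\<close> gives the inequality.
\<close>

lemma gagliardo_lower_bound:
  fixes v :: "real ^ 'n::finite \<Rightarrow> real" and s :: real
  assumes s: "0 < s" "2 * s < CARD('n)" and [measurable]: "v \<in> borel_measurable borel"
  defines "n \<equiv> real CARD('n)"
  defines "p \<equiv> 2 * n / (n - 2 * s)"
  assumes M: "(\<integral>\<^sup>+x. ennreal (\<bar>v x\<bar> powr p) \<partial>lborel) = ennreal M" "M > 0"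
  defines "c \<equiv> 1/4 * (2 / unit_ball_vol n) powr (- ((n + 2 * s) / n)) * 2 powr (- (2 * s * p / n))"
  shows "ennreal (c * M powr (2 / p)) \<le> gagliardo (n + 2 * s) v UNIV UNIV"
proof -
  define q where "q = n + 2 * s"
  define \<omega> where "\<omega> = unit_ball_vol n"
  have n: "n > 0" by (simp add: n_def)
  have p: "p > 0" using s n by (simp add: p_def n_def)
  have q: "q > 0" using s n by (simp add: q_def)
  have \<omega>: "\<omega> > 0" by (simp add: \<omega>_def n_def)
  have c: "c > 0" using \<omega> by (simp add: c_def \<omega>_def)
  define d where "d = c * M powr (- (2 * s / n))"
  \<comment> \<open>The critical exponent is the one for which the power of \<open>a\<close> below is again \<open>p\<close>.\<close>
  have pn: "2 + 2 * s * p / n = p" using s n by (simp add: p_def n_def field_simps)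
  have pt: "ennreal (d * \<bar>v x\<bar> powr p) \<le> (\<integral>\<^sup>+y. ennreal ((v x - v y)\<^sup>2 / norm (x - y) powr q) \<partial>lborel)" for x
  proof (cases "v x = 0")
    case False
    define a where "a = \<bar>v x\<bar>"
    have a: "a > 0" using False by (simp add: a_def)
    define T where "T = 2 powr p * M / a powr p"
    have T: "T > 0" using a M by (simp add: T_def)
    define r where "r = (2 * T / \<omega>) powr (1 / n)"
    have r: "r > 0" using T \<omega> by (simp add: r_def)
    define L where "L = {y. \<bar>v y\<bar> > a / 2}"
    have [measurable]: "L \<in> sets borel" unfolding L_def by measurable
    have "ennreal ((a / 2) powr p) * emeasure lborel L = (\<integral>\<^sup>+y. ennreal ((a / 2) powr p) * indicator L y \<partial>lborel)"
      by (rule nn_integral_cmult_indicator[symmetric]) simp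
    also have "\<dots> \<le> (\<integral>\<^sup>+y. ennreal (\<bar>v y\<bar> powr p) \<partial>lborel)"
      using a p by (intro nn_integral_mono) (auto simp: L_def indicator_def intro!: ennreal_leI powr_mono2)
    also have "\<dots> = ennreal ((a / 2) powr p) * ennreal T"
      using a M by (simp add: T_def powr_divide flip: ennreal_mult)
    finally have VL: "emeasure lborel L \<le> ennreal T"
      using a by (simp add: ennreal_mult_le_mult_iff)
    have VB: "emeasure lborel (cball x r) = ennreal (2 * T)"
    proof -
      have "r ^ CARD('n) = 2 * T / \<omega>"
        using T \<omega> n by (simp add: r_def powr_powr n_def flip: powr_realpow)
      then have "\<omega> * r ^ CARD('n) = 2 * T" using \<omega> by simp
      moreover have "emeasure lborel (cball x r) = ennreal (\<omega> * r ^ CARD('n))"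
        using r by (simp add: emeasure_cball \<omega>_def n_def)
      ultimately show ?thesis by simp
    qed
    have "ennreal T + ennreal T = emeasure lborel (cball x r)"
      using T unfolding VB by (simp add: ennreal_plus[symmetric] del: ennreal_plus)
    also have "\<dots> \<le> emeasure lborel ((cball x r - L) \<union> L)"
      by (intro emeasure_mono) auto
    also have "\<dots> \<le> emeasure lborel (cball x r - L) + emeasure lborel L"
      by (intro emeasure_subadditive) auto
    also have "\<dots> \<le> emeasure lborel (cball x r - L) + ennreal T"
      by (intro add_left_mono VL)
    finally have "ennreal T + ennreal T \<le> ennreal T + emeasure lborel (cball x r - L)"
      by (simp add: add.commute)
    then have vol: "ennreal T \<le> emeasure lborel (cball x r - L)"
      by (simp add: ennreal_add_left_cancel_le)
    have "d * a powr p = a\<^sup>2 / 4 / r powr q * T"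
    proof -
      have "d * a powr p = 1/4 * (2 / \<omega>) powr (- ((n + 2 * s) / n)) * 2 powr (- (2 * s * p / n)) * M powr (- (2 * s / n)) * a powr p"
        by (simp only: d_def c_def \<omega>_def)
      also have "\<dots> = a\<^sup>2 / 4 / ((2 * T / \<omega>) powr (1 / n)) powr (n + 2 * s) * T"
        unfolding T_def by (rule level_set_scaling[OF a M(2) \<omega> n pn])
      also have "\<dots> = a\<^sup>2 / 4 / r powr q * T" by (simp only: r_def q_def)
      finally show ?thesis .
    qed
    then have "ennreal (d * \<bar>v x\<bar> powr p) = ennreal (a\<^sup>2 / 4 / r powr q) * ennreal T"
      using T by (simp add: a_def flip: ennreal_mult)
    also have "\<dots> \<le> ennreal (a\<^sup>2 / 4 / r powr q) * emeasure lborel (cball x r - L)"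
      by (intro mult_left_mono vol) simp
    also have "\<dots> = (\<integral>\<^sup>+y. ennreal (a\<^sup>2 / 4 / r powr q) * indicator (cball x r - L) y \<partial>lborel)"
      by (rule nn_integral_cmult_indicator[symmetric]) simp
    also have "\<dots> \<le> (\<integral>\<^sup>+y. ennreal ((v x - v y)\<^sup>2 / norm (x - y) powr q) \<partial>lborel)"
    proof (intro nn_integral_mono)
      fix y
      show "ennreal (a\<^sup>2 / 4 / r powr q) * indicator (cball x r - L) y \<le> ennreal ((v x - v y)\<^sup>2 / norm (x - y) powr q)"
      proof (cases "y \<in> cball x r - L")
        case True
        then have y: "norm (x - y) \<le> r" "\<bar>v y\<bar> \<le> a / 2" by (auto simp: L_def dist_norm)
        then have "x \<noteq> y" using a by (auto simp: a_def)
        have "\<bar>a / 2\<bar> \<le> \<bar>v x - v y\<bar>" using y(2) unfolding a_def by linarith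
        then have "(a / 2)\<^sup>2 \<le> (v x - v y)\<^sup>2" by (simp only: abs_le_square_iff)
        then have "a\<^sup>2 / 4 / r powr q \<le> (v x - v y)\<^sup>2 / norm (x - y) powr q"
          unfolding power_divide
          using y(1) \<open>x \<noteq> y\<close> q by (intro frac_le powr_mono2) auto
        then show ?thesis using True by (simp add: ennreal_leI)
      qed simp
    qed
    finally show ?thesis .
  qed simp
  have "d * M = c * M powr (2 / p)"
  proof -
    have h: "2 / p = - (2 * s / n) + 1" using s n by (simp add: p_def n_def field_simps)
    have "M powr (2 / p) = M powr (- (2 * s / n)) * M"
      unfolding h powr_add using M(2) by simp
    then show ?thesis unfolding d_def by (simp only: mult.assoc)
  qed
  then have "ennreal (c * M powr (2 / p)) = ennreal (d * M)" by (simp only:)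
  also have "\<dots> = ennreal d * (\<integral>\<^sup>+x. ennreal (\<bar>v x\<bar> powr p) \<partial>lborel)"
    unfolding M(1) using c M(2) by (intro ennreal_mult) (simp_all add: d_def)
  also have "\<dots> = (\<integral>\<^sup>+x. ennreal d * ennreal (\<bar>v x\<bar> powr p) \<partial>lborel)"
    by (rule nn_integral_cmult[symmetric]) measurable
  also have "\<dots> = (\<integral>\<^sup>+x. ennreal (d * \<bar>v x\<bar> powr p) \<partial>lborel)"
    using c by (intro nn_integral_cong ennreal_mult[symmetric]) (auto simp: d_def)
  also have "\<dots> \<le> gagliardo q v UNIV UNIV"
    unfolding gagliardo_def indicator_UNIV mult_1_right by (intro nn_integral_mono pt)
  finally show ?thesis unfolding q_def .
qed

section \<open>Energies as double integrals, and their symmetries\<close>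

lemma energy_eq_iterated:
  fixes v :: "real ^ 'n::finite \<Rightarrow> real"
  assumes [measurable]: "v \<in> borel_measurable borel" "Z \<in> sets borel"
  shows "energy s Z v = ennreal (frac_const CARD('n) s / 2) *
    (\<integral>\<^sup>+x. \<integral>\<^sup>+y. ennreal ((v x - v y)\<^sup>2 / norm (x - y) powr (real CARD('n) + 2 * s)) * indicator Z (x, y) \<partial>lborel \<partial>lborel)"
proof -
  let ?f = "\<lambda>z::(real^'n) \<times> (real^'n). (case z of (x, y) \<Rightarrow>
      ennreal ((v x - v y)\<^sup>2 / norm (x - y) powr (real CARD('n) + 2 * s))) * indicator Z z"
  have Z: "Z \<in> sets (lborel \<Otimes>\<^sub>M lborel)" using assms(2) unfolding lborel_prod by simp
  note [measurable] = Z
  have "(\<integral>\<^sup>+z. ?f z \<partial>lebesgue) = (\<integral>\<^sup>+z. ?f z \<partial>(lborel \<Otimes>\<^sub>M lborel))"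
    by (simp add: nn_integral_completion lborel_prod)
  also have "\<dots> = (\<integral>\<^sup>+x. \<integral>\<^sup>+y. ?f (x, y) \<partial>lborel \<partial>lborel)"
    by (rule lborel.nn_integral_fst[symmetric]) measurable
  finally show ?thesis by (simp add: energy_def)
qed

lemma gagliardo_add_left:
  assumes [measurable]: "v \<in> borel_measurable borel" "A \<in> sets borel" "B \<in> sets borel" "C \<in> sets borel"
    and "AE x in lborel. indicator C x = (indicator A x + indicator B x :: ennreal)"
    and [measurable]: "D \<in> sets borel"
  shows "gagliardo q v C D = gagliardo q v A D + gagliardo q v B D"
proof -
  have "gagliardo q v C D = (\<integral>\<^sup>+x. (\<integral>\<^sup>+y. ennreal ((v x - v y)\<^sup>2 / norm (x - y) powr q) * indicator A x * indicator D y \<partial>lborel)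
      + (\<integral>\<^sup>+y. ennreal ((v x - v y)\<^sup>2 / norm (x - y) powr q) * indicator B x * indicator D y \<partial>lborel) \<partial>lborel)"
    unfolding gagliardo_def
  proof (rule nn_integral_cong_AE, use assms(5) in eventually_elim)
    case (elim x)
    show ?case unfolding elim
      by (subst nn_integral_add[symmetric]) (auto simp: distrib_left distrib_right)
  qed
  also have "\<dots> = gagliardo q v A D + gagliardo q v B D"
    unfolding gagliardo_def by (rule nn_integral_add) measurable
  finally show ?thesis .
qed

lemma gagliardo_commute:
  assumes [measurable]: "v \<in> borel_measurable borel" "A \<in> sets borel" "B \<in> sets borel"
  shows "gagliardo q v A B = gagliardo q v B A"
proof -
  have "gagliardo q v A B = (\<integral>\<^sup>+y. \<integral>\<^sup>+x. ennreal ((v x - v y)\<^sup>2 / norm (x - y) powr q) * indicator A x * indicator B y \<partial>lborel \<partial>lborel)"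
    unfolding gagliardo_def by (rule nn_integral_lborel_swap) measurable
  also have "\<dots> = gagliardo q v B A"
    unfolding gagliardo_def by (intro nn_integral_cong) (simp add: norm_minus_commute power2_commute mult_ac)
  finally show ?thesis .
qed

lemma AE_halfspace_split:
  "AE x in lborel. indicator UNIV x = (indicator (halfspace_pos k) x + indicator (halfspace_neg k) x :: ennreal)"
  using AE_off_hyperplane[of k 0]
  by eventually_elim (auto simp: halfspace_pos_def halfspace_neg_def indicator_def)

lemma gagliardo_UNIV_split:
  fixes v :: "real ^ 'n::finite \<Rightarrow> real"
  assumes [measurable]: "v \<in> borel_measurable borel"
  shows "gagliardo q v UNIV UNIV = gagliardo q v (halfspace_pos k) (halfspace_pos k) + gagliardo q v (halfspace_neg k) (halfspace_neg k)
    + 2 * gagliardo q v (halfspace_pos k) (halfspace_neg k)"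
proof -
  let ?P = "halfspace_pos k" and ?N = "halfspace_neg k"
  have 1: "gagliardo q v UNIV D = gagliardo q v ?P D + gagliardo q v ?N D" if [measurable]: "D \<in> sets borel" for D
    by (rule gagliardo_add_left[OF _ _ _ _ AE_halfspace_split]) auto
  have "gagliardo q v UNIV UNIV = gagliardo q v UNIV ?P + gagliardo q v UNIV ?N"
    by (subst (1 2 3) gagliardo_commute) (auto intro: 1)
  also have "\<dots> = (gagliardo q v ?P ?P + gagliardo q v ?N ?P) + (gagliardo q v ?P ?N + gagliardo q v ?N ?N)"
    by (simp add: 1)
  also have "gagliardo q v ?N ?P = gagliardo q v ?P ?N" by (rule gagliardo_commute) auto
  finally show ?thesis by (simp add: mult_2 ac_simps)
qed

lemma energy_UNIV:
  fixes v :: "real ^ 'n::finite \<Rightarrow> real"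
  assumes "v \<in> borel_measurable borel"
  shows "energy s (UNIV \<times> UNIV) v = ennreal (frac_const CARD('n) s / 2) * gagliardo (real CARD('n) + 2 * s) v UNIV UNIV"
  using assms by (simp add: energy_eq_iterated gagliardo_def)

lemma Sr_domain_measurable [measurable]: "Sr_domain k \<in> sets borel"
proof -
  have "halfspace_neg k \<times> halfspace_neg k \<in> sets (borel \<Otimes>\<^sub>M borel)" by measurable
  then show ?thesis unfolding Sr_domain_def borel_prod by auto
qed

lemma energy_Sr_domain:
  fixes v :: "real ^ 'n::finite \<Rightarrow> real"
  assumes [measurable]: "v \<in> borel_measurable borel"
  shows "energy s (Sr_domain k) v = ennreal (frac_const CARD('n) s / 2) *
    (gagliardo (real CARD('n) + 2 * s) v (halfspace_pos k) (halfspace_pos k)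
     + 2 * gagliardo (real CARD('n) + 2 * s) v (halfspace_pos k) (halfspace_neg k))"
proof -
  let ?P = "halfspace_pos k" and ?N = "halfspace_neg k"
  define q where "q = real CARD('n) + 2 * s"
  let ?d = "\<lambda>x y. ennreal ((v x - v y)\<^sup>2 / norm (x - y) powr q)"
  have "(\<integral>\<^sup>+x. \<integral>\<^sup>+y. ?d x y * indicator (Sr_domain k) (x, y) \<partial>lborel \<partial>lborel)
    = (\<integral>\<^sup>+x. \<integral>\<^sup>+y. (?d x y * indicator ?P x * indicator ?P y + ?d x y * indicator ?P x * indicator ?N y)
          + ?d x y * indicator ?N x * indicator ?P y \<partial>lborel \<partial>lborel)"
  proof (rule nn_integral_cong_AE, use AE_off_hyperplane[of k 0] in eventually_elim)
    case (elim x)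
    then have x: "x $ k < 0 \<or> x $ k > 0" by auto
    show ?case
    proof (rule nn_integral_cong_AE, use AE_off_hyperplane[of k 0] in eventually_elim)
      case (elim y)
      then have "y $ k < 0 \<or> y $ k > 0" by auto
      with x show ?case
        by (auto simp: Sr_domain_def halfspace_pos_def halfspace_neg_def indicator_def)
    qed
  qed
  also have "\<dots> = (\<integral>\<^sup>+x. ((\<integral>\<^sup>+y. ?d x y * indicator ?P x * indicator ?P y \<partial>lborel) + (\<integral>\<^sup>+y. ?d x y * indicator ?P x * indicator ?N y \<partial>lborel))
          + (\<integral>\<^sup>+y. ?d x y * indicator ?N x * indicator ?P y \<partial>lborel) \<partial>lborel)"
    by (intro nn_integral_cong) (simp add: nn_integral_add)
  also have "\<dots> = (gagliardo q v ?P ?P + gagliardo q v ?P ?N) + gagliardo q v ?N ?P"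
    unfolding gagliardo_def by (simp add: nn_integral_add)
  also have "gagliardo q v ?N ?P = gagliardo q v ?P ?N" by (rule gagliardo_commute) auto
  finally show ?thesis
    by (simp add: energy_eq_iterated q_def mult_2 ac_simps)
qed

lemma gagliardo_comp_reflect:
  fixes v :: "real ^ 'n::finite \<Rightarrow> real"
  assumes [measurable]: "v \<in> borel_measurable borel" "A \<in> sets borel" "B \<in> sets borel"
  shows "gagliardo q (\<lambda>x. v (reflect k x)) (reflect k -` A) (reflect k -` B) = gagliardo q v A B"
proof -
  let ?d = "\<lambda>x y. ennreal ((v x - v y)\<^sup>2 / norm (x - y) powr q) * indicator A x * indicator B y"
  have "gagliardo q v A B = (\<integral>\<^sup>+x. \<integral>\<^sup>+y. ?d (reflect k x) y \<partial>lborel \<partial>lborel)"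
    unfolding gagliardo_def by (rule nn_integral_lborel_reflect[symmetric]) measurable
  also have "\<dots> = (\<integral>\<^sup>+x. \<integral>\<^sup>+y. ?d (reflect k x) (reflect k y) \<partial>lborel \<partial>lborel)"
    by (intro nn_integral_cong nn_integral_lborel_reflect[symmetric]) measurable
  also have "\<dots> = gagliardo q (\<lambda>x. v (reflect k x)) (reflect k -` A) (reflect k -` B)"
    unfolding gagliardo_def by (intro nn_integral_cong) (simp add: reflect_diff indicator_def)
  finally show ?thesis by (rule sym)
qed

lemma reflect_vimage_halfspace:
  "reflect k -` halfspace_pos k = halfspace_neg k" "reflect k -` halfspace_neg k = halfspace_pos k"
  by (auto simp: halfspace_pos_def halfspace_neg_def reflect_nth)

lemma gagliardo_comp_translate:
  fixes v :: "real ^ 'n::finite \<Rightarrow> real"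
  assumes [measurable]: "v \<in> borel_measurable borel"
  shows "gagliardo q (\<lambda>x. v (x + t)) UNIV UNIV = gagliardo q v UNIV UNIV"
proof -
  let ?d = "\<lambda>x y. ennreal ((v x - v y)\<^sup>2 / norm (x - y) powr q) * indicator UNIV x * indicator UNIV y"
  have "gagliardo q v UNIV UNIV = (\<integral>\<^sup>+x. \<integral>\<^sup>+y. ?d (x + t) y \<partial>lborel \<partial>lborel)"
    unfolding gagliardo_def by (rule nn_integral_lborel_translate[symmetric]) measurable
  also have "\<dots> = (\<integral>\<^sup>+x. \<integral>\<^sup>+y. ?d (x + t) (y + t) \<partial>lborel \<partial>lborel)"
    by (intro nn_integral_cong nn_integral_lborel_translate[symmetric]) measurable
  also have "\<dots> = gagliardo q (\<lambda>x. v (x + t)) UNIV UNIV"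
    unfolding gagliardo_def by (intro nn_integral_cong) simp
  finally show ?thesis by (rule sym)
qed

text \<open>
Composing with this map turns a function into its even extension from the upper halfspace.
\<close>

definition fold_up :: "'n::finite \<Rightarrow> real ^ 'n \<Rightarrow> real ^ 'n" where
  "fold_up k x = (if x $ k \<ge> 0 then x else reflect k x)"

lemma fold_up_measurable [measurable]: "fold_up k \<in> borel_measurable borel"
  unfolding fold_up_def by measurable

lemma gagliardo_comp_fold_up:
  fixes v :: "real ^ 'n::finite \<Rightarrow> real"
  assumes [measurable]: "v \<in> borel_measurable borel"
  shows "gagliardo q (\<lambda>x. v (fold_up k x)) (halfspace_pos k) (halfspace_pos k) = gagliardo q v (halfspace_pos k) (halfspace_pos k)"
    "gagliardo q (\<lambda>x. v (fold_up k x)) (halfspace_pos k) (halfspace_neg k) = reflected_gagliardo k q v"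
proof -
  show "gagliardo q (\<lambda>x. v (fold_up k x)) (halfspace_pos k) (halfspace_pos k) = gagliardo q v (halfspace_pos k) (halfspace_pos k)"
    unfolding gagliardo_def
    by (intro nn_integral_cong) (auto simp: fold_up_def halfspace_pos_def indicator_def)
  show "gagliardo q (\<lambda>x. v (fold_up k x)) (halfspace_pos k) (halfspace_neg k) = reflected_gagliardo k q v"
    unfolding gagliardo_def reflected_gagliardo_def
  proof (rule nn_integral_cong)
    fix x
    let ?f = "\<lambda>y. ennreal ((v (fold_up k x) - v (fold_up k y))\<^sup>2 / norm (x - y) powr q) * indicator (halfspace_pos k) x * indicator (halfspace_neg k) y"
    have "(\<integral>\<^sup>+y. ?f y \<partial>lborel) = (\<integral>\<^sup>+y. ?f (reflect k y) \<partial>lborel)"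
      by (rule nn_integral_lborel_reflect[symmetric]) measurable
    also have "\<dots> = (\<integral>\<^sup>+y. ennreal ((v x - v y)\<^sup>2 / norm (x - reflect k y) powr q) * indicator (halfspace_pos k) x * indicator (halfspace_pos k) y \<partial>lborel)"
      by (intro nn_integral_cong) (auto simp: fold_up_def halfspace_pos_def halfspace_neg_def indicator_def reflect_nth)
    finally show "(\<integral>\<^sup>+y. ?f y \<partial>lborel) = \<dots>" .
  qed
qed

lemma reflected_gagliardo_le_gag:
  fixes v :: "real ^ 'n::finite \<Rightarrow> real"
  assumes "q \<ge> 0"
  shows "reflected_gagliardo k q v \<le> gagliardo q v (halfspace_pos k) (halfspace_pos k)"
  unfolding gagliardo_def reflected_gagliardo_def
proof (intro nn_integral_mono)
  fix x y :: "real ^ 'n"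
  show "ennreal ((v x - v y)\<^sup>2 / norm (x - reflect k y) powr q) * indicator (halfspace_pos k) x * indicator (halfspace_pos k) y
    \<le> ennreal ((v x - v y)\<^sup>2 / norm (x - y) powr q) * indicator (halfspace_pos k) x * indicator (halfspace_pos k) y"
  proof (cases "x \<in> halfspace_pos k \<and> y \<in> halfspace_pos k \<and> x \<noteq> y")
    case True
    then have "(v x - v y)\<^sup>2 / norm (x - reflect k y) powr q \<le> (v x - v y)\<^sup>2 / norm (x - y) powr q"
      using norm_diff_le_norm_diff_reflect[of x k y] assms
      by (intro frac_le powr_mono2) simp_all
    then show ?thesis using True by (simp add: ennreal_leI)
  qed (auto simp: indicator_def)
qed

lemma AE_lborel_fst_snd:
  fixes P :: "'a::euclidean_space \<Rightarrow> bool"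
  assumes "AE x in lborel. P x"
  shows "AE z in lborel. P (fst z) \<and> P (snd (z :: 'a \<times> 'a))"
proof -
  obtain N where N: "N \<in> null_sets lborel" "{x. \<not> P x} \<subseteq> N"
    using assms by (auto elim!: AE_E simp: null_sets_def)
  have 1: "N \<times> (UNIV :: 'a set) \<in> null_sets (lborel \<Otimes>\<^sub>M lborel)"
    and 2: "(UNIV :: 'a set) \<times> N \<in> null_sets (lborel \<Otimes>\<^sub>M lborel)"
    using N(1) by (auto simp: null_sets_def lborel.emeasure_pair_measure_Times)
  have "AE z in lborel \<Otimes>\<^sub>M lborel. z \<notin> N \<times> (UNIV :: 'a set) \<and> z \<notin> (UNIV :: 'a set) \<times> N"
    using AE_not_in[OF 1] AE_not_in[OF 2] by simp
  then show ?thesis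
    unfolding lborel_prod by (rule eventually_mono) (use N(2) in auto)
qed

text \<open>
Both energies are integrals over the product, so the exceptional null set becomes two null strips.
This allows Lebesgue measurable functions to be replaced by Borel ones.
\<close>

lemma energy_cong_AE:
  fixes u v :: "real ^ 'n::finite \<Rightarrow> real"
  assumes "AE x in lborel. u x = v x"
  shows "energy s Z u = energy s Z v"
  unfolding energy_def nn_integral_completion
proof (intro arg_cong2[where f="(*)"] refl nn_integral_cong_AE, use AE_lborel_fst_snd[OF assms] in eventually_elim)
  case (elim z)
  then show ?case by (cases z) simp
qed

lemma frac_const_pos: "0 < s \<Longrightarrow> s < 1 \<Longrightarrow> frac_const n s > 0"
  unfolding frac_const_def
  by (intro divide_pos_pos mult_pos_pos Gamma_real_pos) (auto intro: add_nonneg_pos)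

section \<open>Test functions and the median hyperplane\<close>

text \<open>
Passing to a Borel representative makes Tonelli's theorem available.
\<close>

lemma space_D_representative:
  fixes u :: "real ^ 'n::finite \<Rightarrow> real" and s :: real
  assumes s: "0 < s" "s < 1" "2 * s < CARD('n)"
    and u: "u \<in> space_D s" "\<not> (AE x in lebesgue. u x = 0)"
  defines "p \<equiv> crit_exp CARD('n) s"
  obtains v :: "real ^ 'n \<Rightarrow> real" and M where "v \<in> borel_measurable borel" "M > 0"
    "(\<integral>\<^sup>+x. ennreal (\<bar>v x\<bar> powr p) \<partial>lborel) = ennreal M"
    "energy s (UNIV \<times> UNIV) u = ennreal (frac_const CARD('n) s / 2) * gagliardo (real CARD('n) + 2 * s) v UNIV UNIV"
    "gagliardo (real CARD('n) + 2 * s) v UNIV UNIV < \<infinity>"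
    "(Lp_norm p UNIV u)\<^sup>2 = M powr (2 / p)"
proof -
  have um: "u \<in> borel_measurable (completion lborel)" and
    fin: "(\<integral>\<^sup>+x. ennreal (\<bar>u x\<bar> powr p) \<partial>lebesgue) < \<infinity>" and
    en: "energy s (UNIV \<times> UNIV) u < \<infinity>"
    using u(1) by (auto simp: space_D_def in_Lp_def p_def lebesgue_on_UNIV_eq)
  obtain v where v: "v \<in> borel_measurable lborel" "AE x in lborel. u x = v x"
    using completion_ex_borel_measurable_real[OF um] by auto
  have vb [measurable]: "v \<in> borel_measurable borel" using v(1) by simp
  have int: "(\<integral>\<^sup>+x. ennreal (\<bar>u x\<bar> powr p) \<partial>lebesgue) = (\<integral>\<^sup>+x. ennreal (\<bar>v x\<bar> powr p) \<partial>lborel)"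
    unfolding nn_integral_completion using v(2) by (intro nn_integral_cong_AE) (auto elim!: eventually_mono)
  obtain M where M: "(\<integral>\<^sup>+x. ennreal (\<bar>v x\<bar> powr p) \<partial>lborel) = ennreal M" "M \<ge> 0"
    using fin unfolding int by (cases "\<integral>\<^sup>+x. ennreal (\<bar>v x\<bar> powr p) \<partial>lborel") auto
  have "M \<noteq> 0"
  proof
    assume "M = 0"
    then have "AE x in lborel. ennreal (\<bar>v x\<bar> powr p) = 0"
      using M by (subst nn_integral_0_iff_AE[symmetric]) auto
    with v(2) have "AE x in lborel. u x = 0"
      by eventually_elim (simp add: ennreal_eq_0_iff)
    then show False using u(2) by (auto dest: AE_completion)
  qed
  with M have M0: "M > 0" by simp
  have e: "energy s (UNIV \<times> UNIV) u = ennreal (frac_const CARD('n) s / 2) * gagliardo (real CARD('n) + 2 * s) v UNIV UNIV"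
    using energy_cong_AE[OF v(2)] energy_UNIV[OF vb] by simp
  show ?thesis
  proof (rule that[OF vb M0 M(1) e])
    show "gagliardo (real CARD('n) + 2 * s) v UNIV UNIV < \<infinity>"
      using en frac_const_pos[OF s(1,2), of "CARD('n)"] unfolding e
      by (auto simp: ennreal_mult_less_top)
    have "Lp_norm p UNIV u = M powr (1 / p)"
      by (simp add: Lp_norm_def lebesgue_on_UNIV_eq int M)
    then show "(Lp_norm p UNIV u)\<^sup>2 = M powr (2 / p)"
      using M0 by (simp add: powr_power)
  qed
qed

text \<open>
The defining inequality of the infimum, with the denominator cleared; for infinite energy it is trivial.
\<close>

lemma sobolev_const_Sr_trial:
  fixes w :: "real ^ 'n::finite \<Rightarrow> real"
  assumes s: "0 < s" "s < 1" and [measurable]: "w \<in> borel_measurable borel"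
  defines "p \<equiv> crit_exp CARD('n) s"
  assumes m: "(\<integral>\<^sup>+x. ennreal (\<bar>w x\<bar> powr p) * indicator (halfspace_pos k) x \<partial>lborel) = ennreal m" "m > 0"
  shows "sobolev_const_Sr k s * ennreal (m powr (2 / p)) \<le> ennreal (frac_const CARD('n) s / 2) *
     (gagliardo (real CARD('n) + 2 * s) w (halfspace_pos k) (halfspace_pos k)
      + 2 * gagliardo (real CARD('n) + 2 * s) w (halfspace_pos k) (halfspace_neg k))"
proof (cases "energy s (Sr_domain k) w < \<infinity>")
  case True
  let ?H = "halfspace_pos k :: (real ^ 'n) set"
  have wl: "w \<in> borel_measurable lebesgue" by (rule measurable_completion) simp
  have H: "?H \<inter> space lebesgue \<in> sets lebesgue" by simp
  have int: "(\<integral>\<^sup>+x. ennreal (\<bar>w x\<bar> powr p) \<partial>lebesgue_on ?H) = ennreal m"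
    unfolding m(1)[symmetric] by (subst nn_integral_restrict_space[OF H]) (simp add: nn_integral_completion)
  have Lp: "in_Lp p ?H w"
    unfolding in_Lp_def int using measurable_restrict_space1[OF wl] by simp
  have nz: "\<not> (AE x in lebesgue_on ?H. w x = 0)"
  proof
    assume "AE x in lebesgue_on ?H. w x = 0"
    then have "(\<integral>\<^sup>+x. ennreal (\<bar>w x\<bar> powr p) \<partial>lebesgue_on ?H) = (\<integral>\<^sup>+x. 0 \<partial>lebesgue_on ?H)"
      by (intro nn_integral_cong_AE) (auto elim!: eventually_mono)
    then show False using m(2) by (simp add: int)
  qed
  have norm: "(Lp_norm p ?H w)\<^sup>2 = m powr (2 / p)"
    using m(2) by (simp add: Lp_norm_def int powr_power)
  have "sobolev_const_Sr k s \<le> energy s (Sr_domain k) w / ennreal ((Lp_norm (crit_exp CARD('n) s) ?H w)\<^sup>2)"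
    unfolding sobolev_const_Sr_def
    by (rule INF_lower) (use wl Lp nz True in \<open>simp add: space_D_Sr_def p_def\<close>)
  also have "(Lp_norm (crit_exp CARD('n) s) ?H w)\<^sup>2 = m powr (2 / p)"
    using norm unfolding p_def .
  finally have "sobolev_const_Sr k s * ennreal (m powr (2 / p)) \<le>
      energy s (Sr_domain k) w / ennreal (m powr (2 / p)) * ennreal (m powr (2 / p))"
    by (rule mult_right_mono) simp
  also have "\<dots> = energy s (Sr_domain k) w"
    using m(2) by (simp add: ennreal_divide_times)
  finally show ?thesis by (simp add: energy_Sr_domain)
next
  case False
  then show ?thesis by (simp add: energy_Sr_domain less_top[symmetric])
qed

text \<open>
The mass below the hyperplane at height \<open>t\<close> is a distribution function. It is continuous because
hyperplanes are null sets, so it attains the value \<open>M / 2\<close>.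
\<close>

lemma median_hyperplane:
  fixes f :: "real ^ 'n::finite \<Rightarrow> ennreal" and k :: 'n
  assumes [measurable]: "f \<in> borel_measurable borel"
    and M: "(\<integral>\<^sup>+x. f x \<partial>lborel) = ennreal M" "M > 0"
  obtains t where
    "(\<integral>\<^sup>+x. f (x + t *\<^sub>R axis k 1) * indicator (halfspace_pos k) x \<partial>lborel) = ennreal (M / 2)"
    "(\<integral>\<^sup>+x. f (x + t *\<^sub>R axis k 1) * indicator (halfspace_neg k) x \<partial>lborel) = ennreal (M / 2)"
proof -
  define \<mu> where "\<mu> = distr (density lborel f) borel (\<lambda>x. x $ k)"
  have em: "emeasure \<mu> A = (\<integral>\<^sup>+x. f x * indicator A (x $ k) \<partial>lborel)" if [measurable]: "A \<in> sets borel" for A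
  proof -
    have "emeasure \<mu> A = emeasure (density lborel f) ((\<lambda>x. x $ k) -` A \<inter> space (density lborel f))"
      unfolding \<mu>_def by (rule emeasure_distr) auto
    also have "\<dots> = (\<integral>\<^sup>+x. f x * indicator ((\<lambda>x. x $ k) -` A) x \<partial>lborel)"
      using measurable_sets[OF nth_measurable[of k], of A] by (subst emeasure_density) auto
    finally show ?thesis by (simp add: indicator_def)
  qed
  have total: "emeasure \<mu> UNIV = ennreal M" using em[of UNIV] M by simp
  have sp: "space \<mu> = UNIV" by (simp add: \<mu>_def)
  have fm: "finite_measure \<mu>" by (rule finite_measureI) (simp add: sp total)
  have sets: "sets \<mu> = sets borel" by (simp add: \<mu>_def)
  interpret finite_borel_measure \<mu>
    using fm sets by (simp add: finite_borel_measure_def finite_borel_measure_axioms_def)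
  have mt: "measure \<mu> UNIV = M" using total M by (simp add: measure_def)
  have pt: "measure \<mu> {x} = 0" for x
  proof -
    have "emeasure \<mu> {x} = (\<integral>\<^sup>+y. 0 \<partial>(lborel :: (real^'n) measure))"
      unfolding em[OF borel_singleton[OF sets.empty_sets]] using AE_off_hyperplane[of k x]
      by (intro nn_integral_cong_AE) (auto elim!: eventually_mono)
    then show ?thesis by (simp add: measure_def)
  qed
  have "eventually (\<lambda>x. cdf \<mu> x < M / 2) at_bot"
    using order_tendstoD(2)[OF cdf_lim_at_bot, of "M / 2"] M by simp
  then obtain a where a: "cdf \<mu> a < M / 2" by (auto simp: eventually_at_bot_linorder)
  have "eventually (\<lambda>x. cdf \<mu> x > M / 2) at_top"
    using order_tendstoD(1)[OF cdf_lim_at_top, of "M / 2"] M mt sp by simp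
  then obtain b where b: "cdf \<mu> b > M / 2" by (auto simp: eventually_at_top_linorder)
  have "a \<le> b" using a b cdf_nondecreasing[of b a] by linarith
  then obtain t where t: "cdf \<mu> t = M / 2"
    using IVT[of "cdf \<mu>" a "M / 2" b] a b by (auto simp: isCont_cdf pt)
  have lo: "measure \<mu> {..<t} = M / 2"
  proof -
    have "measure \<mu> {..t} = measure \<mu> {..<t} + measure \<mu> {t}"
      by (subst finite_measure_Union[symmetric]) (auto intro!: arg_cong[where f="measure \<mu>"])
    then show ?thesis using t pt by (simp add: cdf_def)
  qed
  have hi: "measure \<mu> {t<..} = M / 2"
  proof -
    have "measure \<mu> UNIV = measure \<mu> {..t} + measure \<mu> {t<..}"
      by (subst finite_measure_Union[symmetric]) (auto intro!: arg_cong[where f="measure \<mu>"])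
    then show ?thesis using t mt by (simp add: cdf_def)
  qed
  have sh: "(\<integral>\<^sup>+x. f (x + t *\<^sub>R axis k 1) * indicator C (x $ k + t) \<partial>lborel) = ennreal (M / 2)"
    if [measurable]: "C \<in> sets borel" and "measure \<mu> C = M / 2" for C
  proof -
    have "(\<integral>\<^sup>+x. f (x + t *\<^sub>R axis k 1) * indicator C ((x + t *\<^sub>R axis k 1) $ k) \<partial>lborel) = (\<integral>\<^sup>+x. f x * indicator C (x $ k) \<partial>lborel)"
      by (rule nn_integral_lborel_translate[where f="\<lambda>x. f x * indicator C (x $ k)"]) measurable
    also have "\<dots> = ennreal (M / 2)" using em[of C] that emeasure_eq_measure[of C] by simp
    finally show ?thesis by (simp add: axis_def)
  qed
  show ?thesis
  proof (rule that[of t])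
    show "(\<integral>\<^sup>+x. f (x + t *\<^sub>R axis k 1) * indicator (halfspace_pos k) x \<partial>lborel) = ennreal (M / 2)"
      using sh[OF _ hi] by (simp add: halfspace_pos_def indicator_def)
    show "(\<integral>\<^sup>+x. f (x + t *\<^sub>R axis k 1) * indicator (halfspace_neg k) x \<partial>lborel) = ennreal (M / 2)"
      using sh[OF _ lo] by (simp add: halfspace_neg_def indicator_def)
  qed
qed

text \<open>
The competitors are \<open>v\<close>, its mirror image \<open>w\<close>, and the even extensions of the upper halves of both.
\<close>

lemma four_trial_bounds:
  fixes v :: "real ^ 'n::finite \<Rightarrow> real" and s :: real and k :: 'n
  assumes s: "0 < s" "s < 1" and [measurable]: "v \<in> borel_measurable borel"
  defines "p \<equiv> crit_exp CARD('n) s" and "q \<equiv> real CARD('n) + 2 * s"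
  assumes pos: "(\<integral>\<^sup>+x. ennreal (\<bar>v x\<bar> powr p) * indicator (halfspace_pos k) x \<partial>lborel) = ennreal m"
    and neg: "(\<integral>\<^sup>+x. ennreal (\<bar>v x\<bar> powr p) * indicator (halfspace_neg k) x \<partial>lborel) = ennreal m"
    and m: "m > 0"
  defines "Y \<equiv> sobolev_const_Sr k s * ennreal (m powr (2 / p))"
    and "e \<equiv> ennreal (frac_const CARD('n) s / 2)"
    and "w \<equiv> (\<lambda>x. v (reflect k x))"
  shows "Y \<le> e * (gagliardo q v (halfspace_pos k) (halfspace_pos k) + 2 * gagliardo q v (halfspace_pos k) (halfspace_neg k))"
    "Y \<le> e * (gagliardo q v (halfspace_neg k) (halfspace_neg k) + 2 * gagliardo q v (halfspace_pos k) (halfspace_neg k))"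
    "Y \<le> e * (gagliardo q v (halfspace_pos k) (halfspace_pos k) + 2 * reflected_gagliardo k q v)"
    "Y \<le> e * (gagliardo q v (halfspace_neg k) (halfspace_neg k) + 2 * reflected_gagliardo k q w)"
    "gagliardo q w (halfspace_pos k) (halfspace_pos k) = gagliardo q v (halfspace_neg k) (halfspace_neg k)"
proof -
  let ?P = "halfspace_pos k" and ?N = "halfspace_neg k"
  have [measurable]: "w \<in> borel_measurable borel" unfolding w_def by measurable
  have wpos: "(\<integral>\<^sup>+x. ennreal (\<bar>w x\<bar> powr p) * indicator ?P x \<partial>lborel) = ennreal m"
  proof -
    have "(\<integral>\<^sup>+x. ennreal (\<bar>w x\<bar> powr p) * indicator ?P x \<partial>lborel)
      = (\<integral>\<^sup>+x. ennreal (\<bar>v (reflect k x)\<bar> powr p) * indicator ?N (reflect k x) \<partial>lborel)"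
      unfolding w_def
      by (intro nn_integral_cong) (simp add: indicator_def halfspace_pos_def halfspace_neg_def reflect_nth)
    also have "\<dots> = ennreal m"
      unfolding neg[symmetric]
      by (rule nn_integral_lborel_reflect[where f="\<lambda>x. ennreal (\<bar>v x\<bar> powr p) * indicator ?N x"]) measurable
    finally show ?thesis .
  qed
  have fold: "(\<integral>\<^sup>+x. ennreal (\<bar>f (fold_up k x)\<bar> powr p) * indicator ?P x \<partial>lborel)
      = (\<integral>\<^sup>+x. ennreal (\<bar>f x\<bar> powr p) * indicator ?P x \<partial>lborel)" for f :: "real ^ 'n \<Rightarrow> real"
    by (intro nn_integral_cong) (auto simp: fold_up_def halfspace_pos_def indicator_def)
  have wPP: "gagliardo q w ?P ?P = gagliardo q v ?N ?N"
    using gagliardo_comp_reflect[of v ?N ?N q k] by (simp add: w_def reflect_vimage_halfspace)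
  have wPN: "gagliardo q w ?P ?N = gagliardo q v ?P ?N"
    using gagliardo_comp_reflect[of v ?N ?P q k] gagliardo_commute[of v ?P ?N q] by (simp add: w_def reflect_vimage_halfspace)
  note trial = sobolev_const_Sr_trial[OF s, where k=k, folded p_def q_def e_def]
  show "Y \<le> e * (gagliardo q v ?P ?P + 2 * gagliardo q v ?P ?N)"
    unfolding Y_def by (rule trial[OF _ pos m]) measurable
  show "Y \<le> e * (gagliardo q v ?N ?N + 2 * gagliardo q v ?P ?N)"
    unfolding Y_def wPP[symmetric] wPN[symmetric] by (rule trial[OF _ wpos m]) measurable
  have "Y \<le> e * (gagliardo q (\<lambda>x. v (fold_up k x)) ?P ?P + 2 * gagliardo q (\<lambda>x. v (fold_up k x)) ?P ?N)"
    unfolding Y_def by (rule trial[OF _ _ m]) (measurable, simp only: fold pos)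
  then show "Y \<le> e * (gagliardo q v ?P ?P + 2 * reflected_gagliardo k q v)"
    by (simp add: gagliardo_comp_fold_up)
  have "Y \<le> e * (gagliardo q (\<lambda>x. w (fold_up k x)) ?P ?P + 2 * gagliardo q (\<lambda>x. w (fold_up k x)) ?P ?N)"
    unfolding Y_def by (rule trial[OF _ _ m]) (measurable, simp only: fold wpos)
  then show "Y \<le> e * (gagliardo q v ?N ?N + 2 * reflected_gagliardo k q w)"
    by (simp add: gagliardo_comp_fold_up wPP)
  show "gagliardo q w ?P ?P = gagliardo q v ?N ?N" by (rule wPP)
qed

text \<open>
The two alternatives for \<open>\<beta>\<close> correspond to the two ways to choose the competitors: \<open>3/2\<close> comes from a
convex combination of all four of them, and \<open>1 + 2 \<eta>\<close> comes from the even extensions alone, provided that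
their cross energies are small.
\<close>

lemma halved_energy_bound:
  fixes v :: "real ^ 'n::finite \<Rightarrow> real" and s :: real and k :: 'n
  assumes s: "0 < s" "s < 1" and v [measurable]: "v \<in> borel_measurable borel"
  defines "p \<equiv> crit_exp CARD('n) s" and "q \<equiv> real CARD('n) + 2 * s"
  assumes M: "(\<integral>\<^sup>+x. ennreal (\<bar>v x\<bar> powr p) \<partial>lborel) = ennreal M" "M > 0"
    and fin: "gagliardo q v UNIV UNIV < \<infinity>"
    and \<beta>: "\<beta> = 3 / 2 \<or> (\<exists>\<eta>\<ge>0. \<beta> = 1 + 2 * \<eta> \<and> (\<forall>w. w \<in> borel_measurable borel \<longrightarrow>
        gagliardo q w (halfspace_pos k) (halfspace_pos k) < \<infinity> \<longrightarrow>
        reflected_gagliardo k q w \<le> ennreal \<eta> * gagliardo q w (halfspace_pos k) (halfspace_pos k)))"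
  shows "2 * (sobolev_const_Sr k s * ennreal ((M / 2) powr (2 / p)))
    \<le> ennreal \<beta> * (ennreal (frac_const CARD('n) s / 2) * gagliardo q v UNIV UNIV)"
proof -
  let ?P = "halfspace_pos k" and ?N = "halfspace_neg k"
  obtain t where
    "(\<integral>\<^sup>+x. ennreal (\<bar>v (x + t *\<^sub>R axis k 1)\<bar> powr p) * indicator ?P x \<partial>lborel) = ennreal (M / 2)"
    "(\<integral>\<^sup>+x. ennreal (\<bar>v (x + t *\<^sub>R axis k 1)\<bar> powr p) * indicator ?N x \<partial>lborel) = ennreal (M / 2)"
    using median_hyperplane[of "\<lambda>x. ennreal (\<bar>v x\<bar> powr p)" M k] M by (auto, measurable)
  note halves = this
  define v' where "v' = (\<lambda>x. v (x + t *\<^sub>R axis k 1))"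
  have v' [measurable]: "v' \<in> borel_measurable borel" unfolding v'_def by measurable
  define w where "w = (\<lambda>x. v' (reflect k x))"
  have w [measurable]: "w \<in> borel_measurable borel" unfolding w_def by measurable
  have same: "gagliardo q v UNIV UNIV = gagliardo q v' UNIV UNIV"
    unfolding v'_def by (rule gagliardo_comp_translate[symmetric]) fact
  define Y where "Y = sobolev_const_Sr k s * ennreal ((M / 2) powr (2 / p))"
  define \<epsilon> where "\<epsilon> = frac_const CARD('n) s / 2"
  have \<epsilon>: "\<epsilon> > 0" using frac_const_pos[OF s] by (simp add: \<epsilon>_def)
  have M2: "M / 2 > 0" using M by simp
  have hP: "(\<integral>\<^sup>+x. ennreal (\<bar>v' x\<bar> powr crit_exp CARD('n) s) * indicator ?P x \<partial>lborel) = ennreal (M / 2)"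
    and hN: "(\<integral>\<^sup>+x. ennreal (\<bar>v' x\<bar> powr crit_exp CARD('n) s) * indicator ?N x \<partial>lborel) = ennreal (M / 2)"
    using halves unfolding v'_def p_def by (simp_all only:)
  note bounds = four_trial_bounds[OF s v' hP hN M2,
      folded p_def q_def \<epsilon>_def w_def, folded Y_def]
  have split: "gagliardo q v' UNIV UNIV = gagliardo q v' ?P ?P + gagliardo q v' ?N ?N + 2 * gagliardo q v' ?P ?N"
    by (rule gagliardo_UNIV_split) fact
  have fin': "gagliardo q v' ?P ?P < \<infinity>" "gagliardo q v' ?N ?N < \<infinity>" "gagliardo q v' ?P ?N < \<infinity>"
    using fin unfolding same split by (auto simp: ennreal_mult_less_top)
  obtain a where a: "gagliardo q v' ?P ?P = ennreal a" "a \<ge> 0" using fin'(1) by (cases "gagliardo q v' ?P ?P") auto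
  obtain b where b: "gagliardo q v' ?N ?N = ennreal b" "b \<ge> 0" using fin'(2) by (cases "gagliardo q v' ?N ?N") auto
  obtain c where c: "gagliardo q v' ?P ?N = ennreal c" "c \<ge> 0" using fin'(3) by (cases "gagliardo q v' ?P ?N") auto
  have q0: "q \<ge> 0" using s by (simp add: q_def)
  have "reflected_gagliardo k q v' \<le> ennreal a" using reflected_gagliardo_le_gag[OF q0, of k v'] a by simp
  then obtain r where r: "reflected_gagliardo k q v' = ennreal r" "r \<ge> 0" "r \<le> a"
    using a(2) by (cases "reflected_gagliardo k q v'") (auto simp: top_unique)
  have "reflected_gagliardo k q w \<le> ennreal b" using reflected_gagliardo_le_gag[OF q0, of k w] b bounds(5) by simp
  then obtain r' where r': "reflected_gagliardo k q w = ennreal r'" "r' \<ge> 0" "r' \<le> b"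
    using b(2) by (cases "reflected_gagliardo k q w") (auto simp: top_unique)
  have conv: "ennreal \<epsilon> * (ennreal x + 2 * ennreal y) = ennreal (\<epsilon> * (x + 2 * y))" if "x \<ge> 0" "y \<ge> 0" for x y
    using that \<epsilon> by (simp add: ennreal_mult ennreal_plus)
  have Y1: "Y \<le> ennreal (\<epsilon> * (a + 2 * c))" using bounds(1) unfolding a c by (simp only: conv[OF a(2) c(2)])
  have Y2: "Y \<le> ennreal (\<epsilon> * (b + 2 * c))" using bounds(2) unfolding b c by (simp only: conv[OF b(2) c(2)])
  have Y3: "Y \<le> ennreal (\<epsilon> * (a + 2 * r))" using bounds(3) unfolding a r by (simp only: conv[OF a(2) r(2)])
  have Y4: "Y \<le> ennreal (\<epsilon> * (b + 2 * r'))" using bounds(4) unfolding b r' by (simp only: conv[OF b(2) r'(2)])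
  obtain y where y: "Y = ennreal y" "y \<ge> 0" using Y1 by (cases Y) (auto simp: top_unique)
  have nn: "\<epsilon> * (a + 2 * c) \<ge> 0" "\<epsilon> * (b + 2 * c) \<ge> 0" "\<epsilon> * (a + 2 * r) \<ge> 0" "\<epsilon> * (b + 2 * r') \<ge> 0"
    using \<epsilon> a b c r r' by auto
  have y1: "y \<le> \<epsilon> * (a + 2 * c)" and y2: "y \<le> \<epsilon> * (b + 2 * c)"
    and y3: "y \<le> \<epsilon> * (a + 2 * r)" and y4: "y \<le> \<epsilon> * (b + 2 * r')"
    using Y1 Y2 Y3 Y4 nn unfolding y by (simp_all only: ennreal_le_iff)
  have "2 * y \<le> \<beta> * (\<epsilon> * (a + b + 2 * c))"
    using \<beta>
  proof
    \<comment> \<open>The bounds \<open>y1\<close>, \<open>y2\<close> enter with weight \<open>3/4\<close> and \<open>y3\<close>, \<open>y4\<close> with weight \<open>1/4\<close>: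
      \<open>3/4 (a + b + 4c) + 1/4 * 3 (a + b) = 3/2 (a + b + 2c)\<close>.\<close>
    assume \<beta>: "\<beta> = 3 / 2"
    have "\<epsilon> * r \<le> \<epsilon> * a" "\<epsilon> * r' \<le> \<epsilon> * b" using r r' \<epsilon> by auto
    then show ?thesis
      using y1 y2 y3 y4 unfolding \<beta> by (simp add: algebra_simps)
  next
    assume "\<exists>\<eta>\<ge>0. \<beta> = 1 + 2 * \<eta> \<and> (\<forall>w. w \<in> borel_measurable borel \<longrightarrow>
        gagliardo q w ?P ?P < \<infinity> \<longrightarrow> reflected_gagliardo k q w \<le> ennreal \<eta> * gagliardo q w ?P ?P)"
    then obtain \<eta> where \<eta>: "\<eta> \<ge> 0" "\<beta> = 1 + 2 * \<eta>" and
      small: "\<And>w. w \<in> borel_measurable borel \<Longrightarrow> gagliardo q w ?P ?P < \<infinity> \<Longrightarrow> reflected_gagliardo k q w \<le> ennreal \<eta> * gagliardo q w ?P ?P"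
      by blast
    have "r \<le> \<eta> * a"
      using small[OF v' fin'(1)] a r \<eta> by (simp add: ennreal_mult[symmetric] ennreal_le_iff)
    moreover have "r' \<le> \<eta> * b"
      using small[OF w] bounds(5) fin'(2) b r' \<eta> by (simp add: ennreal_mult[symmetric] ennreal_le_iff)
    ultimately have "\<epsilon> * (a + 2 * r) + \<epsilon> * (b + 2 * r') \<le> \<epsilon> * (a + 2 * (\<eta> * a)) + \<epsilon> * (b + 2 * (\<eta> * b))"
      using \<epsilon> by (intro add_mono mult_left_mono) auto
    also have "\<dots> = \<beta> * (\<epsilon> * (a + b))" by (simp add: \<eta> algebra_simps)
    also have "\<dots> \<le> \<beta> * (\<epsilon> * (a + b + 2 * c))"
      using \<eta> \<epsilon> c by (intro mult_left_mono) auto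
    finally show ?thesis using y3 y4 by linarith
  qed
  then have "ennreal (2 * y) \<le> ennreal (\<beta> * (\<epsilon> * (a + b + 2 * c)))" by (rule ennreal_leI)
  also have "\<dots> = ennreal \<beta> * (ennreal \<epsilon> * (ennreal a + ennreal b + 2 * ennreal c))"
    using \<beta> \<epsilon> a b c by (auto simp: ennreal_mult ennreal_plus)
  finally show ?thesis
    unfolding Y_def[symmetric] \<epsilon>_def[symmetric] same split a b c y using y(2) by (simp add: ennreal_mult)
qed

lemma bump_in_space_D:
  fixes s :: real
  assumes s: "0 < s" "s < 1" "2 * s < CARD('n::finite)"
  defines "u \<equiv> (\<lambda>x::real^'n. max 0 (1 - norm x))"
  shows "u \<in> space_D s" "\<not> (AE x in lebesgue. u x = 0)"
proof -
  have ub [measurable]: "u \<in> borel_measurable borel" unfolding u_def by measurable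
  define p where "p = crit_exp CARD('n) s"
  have p: "p > 0" using s by (simp add: p_def crit_exp_def)
  have "(\<integral>\<^sup>+x. ennreal (\<bar>u x\<bar> powr p) \<partial>lebesgue) = (\<integral>\<^sup>+x. ennreal (\<bar>u x\<bar> powr p) \<partial>lborel)"
    by (simp add: nn_integral_completion)
  also have "\<dots> \<le> (\<integral>\<^sup>+x. indicator (cball 0 1) x \<partial>(lborel :: (real^'n) measure))"
    using p by (intro nn_integral_mono) (auto simp: u_def indicator_def max_def powr_le1)
  also have "\<dots> < \<infinity>" by (simp add: emeasure_cball)
  finally have Lp: "in_Lp p UNIV u"
    by (simp add: in_Lp_def lebesgue_on_UNIV_eq measurable_completion)
  have "energy s (UNIV \<times> UNIV) u < \<infinity>"
    unfolding energy_UNIV[OF ub] using gagliardo_bump_finite[OF s(1,2), where 'n='n]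
    by (simp add: u_def ennreal_mult_less_top)
  with Lp show "u \<in> space_D s" by (simp add: space_D_def p_def)
  show "\<not> (AE x in lebesgue. u x = 0)"
  proof
    assume "AE x in lebesgue. u x = 0"
    then have "AE x in lborel. u x = 0" by (simp add: AE_completion_iff)
    then have "AE x in lborel. x \<notin> ball (0 :: real^'n) 1"
      by eventually_elim (auto simp: u_def max_def split: if_splits)
    then have "ball (0 :: real^'n) 1 \<in> null_sets lborel" by (subst AE_iff_null_sets) auto
    then have "emeasure lborel (ball (0 :: real^'n) 1) = 0" by auto
    then show False using unit_ball_vol_pos[of "real CARD('n)"]
      by (simp add: emeasure_ball ennreal_eq_0_iff del: unit_ball_vol_pos)
  qed
qed

section \<open>Comparison of the best constants\<close>

text \<open>
Halving the mass changes \<open>M powr (2 / p)\<close> by the factor \<open>(1/2) powr (2/p)\<close>, and \<open>2 * (1/2) powr (2/p)\<close> equals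
\<open>2 powr (2s/n)\<close>. The strict inequality between the constants needs the full one to be positive and finite.
\<close>

lemma sobolev_const_Sr_less:
  fixes s :: real and k :: "'n::finite"
  assumes s: "0 < s" "s < 1" "2 * s < CARD('n)"
  defines "q \<equiv> real CARD('n) + 2 * s"
  assumes \<beta>: "\<beta> = 3 / 2 \<or> (\<exists>\<eta>\<ge>0. \<beta> = 1 + 2 * \<eta> \<and> (\<forall>w. w \<in> borel_measurable borel \<longrightarrow>
        gagliardo q w (halfspace_pos k) (halfspace_pos k) < \<infinity> \<longrightarrow>
        reflected_gagliardo k q w \<le> ennreal \<eta> * gagliardo q w (halfspace_pos k) (halfspace_pos k)))"
    and less: "\<beta> < 2 powr (2 * s / real CARD('n))"
  shows "sobolev_const_Sr k s < sobolev_const TYPE('n) s"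
proof -
  define n where "n = real CARD('n)"
  define p where "p = crit_exp CARD('n) s"
  define \<epsilon> where "\<epsilon> = frac_const CARD('n) s / 2"
  have \<epsilon>: "\<epsilon> > 0" using frac_const_pos[OF s(1,2)] by (simp add: \<epsilon>_def)
  define d where "d = 2 powr (2 * s / n)"
  have d: "d > 0" "\<beta> < d" using less by (auto simp: d_def n_def)
  have \<beta>0: "\<beta> > 0" using \<beta> by auto
  have n: "n > 0" by (simp add: n_def)
  define c where "c = 1/4 * (2 / unit_ball_vol n) powr (- ((n + 2 * s) / n)) * 2 powr (- (2 * s * p / n))"
  have "2 / unit_ball_vol n \<noteq> 0" using unit_ball_vol_pos[of n] n by (simp del: unit_ball_vol_pos)
  then have c: "c > 0" unfolding c_def by (intro mult_pos_pos) simp_all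
  let ?A = "{u \<in> space_D s. \<not> (AE x in lebesgue. u x = 0)} :: (real ^ 'n \<Rightarrow> real) set"
  let ?Q = "\<lambda>u :: real ^ 'n \<Rightarrow> real. energy s (UNIV \<times> UNIV) u / ennreal ((Lp_norm (crit_exp CARD('n) s) UNIV u)\<^sup>2)"
  have main: "ennreal (d / \<beta>) * sobolev_const_Sr k s \<le> ?Q u \<and> ennreal (\<epsilon> * c) \<le> ?Q u \<and> ?Q u < \<infinity>
      \<and> sobolev_const_Sr k s < \<infinity>" if "u \<in> ?A" for u
  proof -
    from that have u: "u \<in> space_D s" "\<not> (AE x in lebesgue. u x = 0)" by auto
    obtain v :: "real ^ 'n \<Rightarrow> real" and M where v: "v \<in> borel_measurable borel" and M: "M > 0"
      "(\<integral>\<^sup>+x. ennreal (\<bar>v x\<bar> powr p) \<partial>lborel) = ennreal M"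
      and e: "energy s (UNIV \<times> UNIV) u = ennreal \<epsilon> * gagliardo q v UNIV UNIV"
      and fin: "gagliardo q v UNIV UNIV < \<infinity>" and L: "(Lp_norm p UNIV u)\<^sup>2 = M powr (2 / p)"
      by (rule space_D_representative[OF s u, folded p_def q_def \<epsilon>_def])
    obtain G where G: "gagliardo q v UNIV UNIV = ennreal G" "G \<ge> 0" using fin by (cases "gagliardo q v UNIV UNIV") auto
    define m where "m = M powr (2 / p)"
    have m: "m > 0" using M by (simp add: m_def)
    have Q: "?Q u = ennreal (\<epsilon> * G / m)"
      unfolding e G p_def[symmetric] L m_def[symmetric] using \<epsilon> G(2) m
      by (simp add: ennreal_mult[symmetric] divide_ennreal)
    have "ennreal (c * m) \<le> gagliardo q v UNIV UNIV"
      using gagliardo_lower_bound[OF s(1,3) v, folded n_def] M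
      unfolding p_def crit_exp_def c_def m_def q_def n_def by simp
    then have "c * m \<le> G" using G by (simp add: ennreal_le_iff)
    then have "\<epsilon> * c \<le> \<epsilon> * G / m" using m \<epsilon> by (simp add: field_simps)
    then have 2: "ennreal (\<epsilon> * c) \<le> ?Q u" unfolding Q by (rule ennreal_leI)
    have half: "2 * (sobolev_const_Sr k s * ennreal ((M / 2) powr (2 / p))) \<le> ennreal \<beta> * (ennreal \<epsilon> * gagliardo q v UNIV UNIV)"
      unfolding p_def q_def \<epsilon>_def
      by (rule halved_energy_bound[OF s(1,2) v]) (use M fin \<beta> in \<open>auto simp: p_def q_def\<close>)
    have peq: "p = 2 * n / (n - 2 * s)" by (simp add: p_def crit_exp_def n_def)
    have "2 / p = 1 - 2 * s / n" unfolding peq using n by (simp add: diff_divide_distrib)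
    then have "(1 / 2) powr (2 / p) = 2 powr (2 * s / n - 1)" by (simp add: powr_divide powr_diff)
    then have "2 * (1 / 2) powr (2 / p) = d" by (simp add: d_def powr_diff)
    moreover have "(M / 2) powr (2 / p) = m * (1 / 2) powr (2 / p)"
      unfolding m_def powr_mult[symmetric] by simp
    ultimately have dm: "2 * (M / 2) powr (2 / p) = d * m" by simp
    have "sobolev_const_Sr k s * ennreal (d * m) = 2 * (sobolev_const_Sr k s * ennreal ((M / 2) powr (2 / p)))"
      unfolding dm[symmetric] by (simp add: ennreal_mult mult_ac)
    also have "\<dots> \<le> ennreal (\<beta> * \<epsilon> * G)"
      using half \<beta>0 \<epsilon> G by (simp add: ennreal_mult mult.assoc)
    finally have Sd: "sobolev_const_Sr k s * ennreal (d * m) \<le> ennreal (\<beta> * \<epsilon> * G)" .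
    have dm0: "d * m > 0" using d m by simp
    have Sfin: "sobolev_const_Sr k s < \<infinity>"
    proof (rule ccontr)
      assume "\<not> sobolev_const_Sr k s < \<infinity>"
      then have "sobolev_const_Sr k s = \<infinity>" by (simp add: less_top[symmetric])
      then show False using Sd d m by (simp add: ennreal_top_mult top_unique)
    qed
    then obtain r where r: "sobolev_const_Sr k s = ennreal r" "r \<ge> 0" by (cases "sobolev_const_Sr k s") auto
    have "r * (d * m) \<le> \<beta> * \<epsilon> * G"
      using Sd r dm0 \<beta>0 \<epsilon> G by (simp add: ennreal_mult[symmetric] ennreal_le_iff)
    then have "d / \<beta> * r \<le> \<epsilon> * G / m" using m \<beta>0 by (simp add: field_simps)
    then have "ennreal (d / \<beta>) * sobolev_const_Sr k s \<le> ?Q u"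
      unfolding Q r using d \<beta>0 r(2) by (subst ennreal_mult[symmetric]) (auto intro: ennreal_leI)
    with 2 Sfin show ?thesis unfolding Q by simp
  qed
  have ex: "(\<lambda>x::real^'n. max 0 (1 - norm x)) \<in> ?A" using bump_in_space_D[OF s] by simp
  have S: "sobolev_const TYPE('n) s = (INF u\<in>?A. ?Q u)" by (simp add: sobolev_const_def)
  have S1: "ennreal (d / \<beta>) * sobolev_const_Sr k s \<le> sobolev_const TYPE('n) s"
    unfolding S using main by (intro INF_greatest) blast
  have S2: "ennreal (\<epsilon> * c) \<le> sobolev_const TYPE('n) s"
    unfolding S using main by (intro INF_greatest) blast
  have S3: "sobolev_const TYPE('n) s < \<infinity>"
    unfolding S using main[OF ex] by (intro le_less_trans[OF INF_lower[OF ex]]) blast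
  obtain \<sigma> where \<sigma>: "sobolev_const TYPE('n) s = ennreal \<sigma>" "\<sigma> \<ge> 0" using S3 by (cases "sobolev_const TYPE('n) s") auto
  obtain r where r: "sobolev_const_Sr k s = ennreal r" "r \<ge> 0" using main[OF ex] by (cases "sobolev_const_Sr k s") auto
  have "\<epsilon> * c \<le> \<sigma>" using S2 unfolding \<sigma>(1) by (simp only: ennreal_le_iff[OF \<sigma>(2)])
  then have \<sigma>0: "\<sigma> > 0" by (rule less_le_trans[OF mult_pos_pos[OF \<epsilon> c]])
  have "ennreal (d / \<beta> * r) = ennreal (d / \<beta>) * ennreal r"
    using d \<beta>0 r(2) by (intro ennreal_mult) auto
  then have "ennreal (d / \<beta> * r) \<le> ennreal \<sigma>"
    using S1 unfolding r(1) \<sigma>(1) by (simp only:)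
  then have "d / \<beta> * r \<le> \<sigma>" by (simp only: ennreal_le_iff[OF \<sigma>(2)])
  then have "\<beta> * (d / \<beta> * r) \<le> \<beta> * \<sigma>" using \<beta>0 by (intro mult_left_mono) auto
  moreover have "\<beta> * (d / \<beta> * r) = d * r" using \<beta>0 by simp
  ultimately have "d * r \<le> \<beta> * \<sigma>" by (simp only:)
  also have "\<dots> < d * \<sigma>" using d(2) \<sigma>0 by (rule mult_strict_right_mono)
  finally have "r < \<sigma>" using d(1) by simp
  then show ?thesis unfolding r(1) \<sigma>(1) by (simp only: ennreal_less_iff[OF r(2)])
qed

theorem theorem4p7:
  shows "(CARD('n::finite) \<ge> 2 \<longrightarrow>
           (\<exists>s0. 0 < s0 \<and> s0 < 1 \<and>
             (\<forall>s. s0 < s \<and> s < 1 \<longrightarrow>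
               (\<forall>k::'n. sobolev_const_Sr k s < sobolev_const TYPE('n) s))))
       \<and> (CARD('n) = 1 \<longrightarrow>
           (\<exists>s0. 0 < s0 \<and> s0 < 1 / 2 \<and>
             (\<forall>s. s0 < s \<and> s < 1 / 2 \<longrightarrow>
               (\<forall>k::'n. sobolev_const_Sr k s < sobolev_const TYPE('n) s))))"
proof (intro conjI impI)
  assume n: "CARD('n) \<ge> 2"
  define D where "D = 2 powr (1 / real CARD('n))"
  have "2 powr 0 < D" unfolding D_def using n by (intro powr_less_mono) auto
  then have D: "1 < D" by simp
  define \<eta> where "\<eta> = (D - 1) / 4"
  have \<eta>: "\<eta> > 0" and \<eta>_less: "1 + 2 * \<eta> < D" using D by (simp_all add: \<eta>_def field_simps)
  obtain s0 where s0: "0 < s0" "s0 < 1" and small: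
    "\<And>s (v :: real ^ 'n \<Rightarrow> real) k. s0 < s \<Longrightarrow> s < 1 \<Longrightarrow> v \<in> borel_measurable borel \<Longrightarrow>
       gagliardo (real CARD('n) + 2 * s) v (halfspace_pos k) (halfspace_pos k) < \<infinity> \<Longrightarrow>
       reflected_gagliardo k (real CARD('n) + 2 * s) v
         \<le> ennreal \<eta> * gagliardo (real CARD('n) + 2 * s) v (halfspace_pos k) (halfspace_pos k)"
    using reflected_gagliardo_small[OF \<eta>, where 'n='n] by blast
  show "\<exists>s0. 0 < s0 \<and> s0 < 1 \<and> (\<forall>s. s0 < s \<and> s < 1 \<longrightarrow>
               (\<forall>k::'n. sobolev_const_Sr k s < sobolev_const TYPE('n) s))"
  \<comment> \<open>From \<open>s \<ge> 1/2\<close> the factor \<open>2 powr (2s/n)\<close> is at least \<open>D\<close>, uniformly in \<open>s\<close>.\<close>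
  proof (intro exI[of _ "max s0 (1/2)"] conjI allI impI)
    fix s and k :: 'n
    assume s: "max s0 (1/2) < s \<and> s < 1"
    have "2 powr (1 / real CARD('n)) \<le> 2 powr (2 * s / real CARD('n))"
      using s by (intro powr_mono divide_right_mono) auto
    with \<eta>_less have less: "1 + 2 * \<eta> < 2 powr (2 * s / real CARD('n))"
      unfolding D_def[symmetric] by (rule less_le_trans)
    show "sobolev_const_Sr k s < sobolev_const TYPE('n) s"
    proof (rule sobolev_const_Sr_less[OF _ _ _ _ less])
      show "1 + 2 * \<eta> = 3 / 2 \<or> (\<exists>\<eta>'\<ge>0. 1 + 2 * \<eta> = 1 + 2 * \<eta>' \<and> (\<forall>w. w \<in> borel_measurable borel \<longrightarrow>
        gagliardo (real CARD('n) + 2 * s) w (halfspace_pos k) (halfspace_pos k) < \<infinity> \<longrightarrow>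
        reflected_gagliardo k (real CARD('n) + 2 * s) w \<le> ennreal \<eta>' * gagliardo (real CARD('n) + 2 * s) w (halfspace_pos k) (halfspace_pos k)))"
        using small[of s _ k] s \<eta> by (intro disjI2 exI[of _ \<eta>]) auto
    qed (use s n in auto)
  qed (use s0 in auto)
next
  assume n: "CARD('n) = 1"
  show "\<exists>s0. 0 < s0 \<and> s0 < 1 / 2 \<and> (\<forall>s. s0 < s \<and> s < 1 / 2 \<longrightarrow>
               (\<forall>k::'n. sobolev_const_Sr k s < sobolev_const TYPE('n) s))"
  \<comment> \<open>The value \<open>2/5\<close> is chosen for \<open>2 powr (4/5) > 3/2\<close>, that is, \<open>16 > (3/2)^5\<close>.\<close>
  proof (intro exI[of _ "2/5"] conjI allI impI)
    fix s :: real and k :: 'n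
    assume s: "2/5 < s \<and> s < 1/2"
    have "(3/2 :: real) ^ 5 < (2 powr (4/5)) ^ 5" by (simp add: powr_power power_divide)
    then have "3/2 < (2::real) powr (4/5)" by (rule power_less_imp_less_base) simp
    also have "\<dots> < 2 powr (2 * s / real CARD('n))" using s n by (intro powr_less_mono) auto
    finally have less: "3/2 < 2 powr (2 * s / real CARD('n))" .
    show "sobolev_const_Sr k s < sobolev_const TYPE('n) s"
      by (rule sobolev_const_Sr_less[OF _ _ _ _ less]) (use s n in auto)
  qed auto
qed

end
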